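(* Let $p>3$ be a prime. Then $$\sum_{n=0}^{p-1}\frac{6n+1}{256^n}\binom{2n}{n}^3\equiv p(-1)^{(p-1)/2}-p^3E_{p-3}\pmod{p^4}.$$
   Context: $E_n$ denotes the $n$-th Euler number, defined by $E_0=1$ and $E_n=-\sum_{k=1}^{\lfloor n/2\rfloor}\binom{n}{2k}E_{n-2k}$ for $n\ge1$. For rationals $a,b$ and an integer $m\ge1$, $a\equiv b\pmod{p^m}$ means that $a-b=p^m c$ for some rational $c$ whose denominator is not divisible by $p$. *)

theory Defs
  imports Complex_Main "HOL-Computational_Algebra.Primes"
begin

function euler_num :: "nat \<Rightarrow> int" where
  "euler_num n = (if n = 0 then 1
     else - (\<Sum>k\<in>{1..n div 2}. int (n choose (2*k)) * euler_num (n - 2*k)))"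
  by auto
termination
  by (relation "measure id") auto

declare euler_num.simps[simp del]

definition rat_cong :: "rat \<Rightarrow> rat \<Rightarrow> nat \<Rightarrow> nat \<Rightarrow> bool" where
  "rat_cong a b p m \<longleftrightarrow>
     (\<exists>c::rat. a - b = of_nat (p ^ m) * c \<and> \<not> int p dvd snd (quotient_of c))"

end

theory Submission
  imports Defs "HOL-Number_Theory.Residues" "HOL-Computational_Algebra.Polynomial"
begin

text \<open>
  Deform the summand to
  \[ t_n(y) = (6n+1) \frac{(1/2)_n}{n!} \prod_{j<n} \frac{(2j+1)^2-y}{16(j+1)^2-y}, \]
  so that \<open>t_n(0)\<close> is the original summand. At \<open>y = (2M+1)^2\<close> the series terminates, and a
  Wilf--Zeilberger pair evaluates it to \<open>(-1)^M (2M+1)\<close>. Multiplied by \<open>\<Prod>\<^sub>i (16 i\<^sup>2 - y)\<close>,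
  \<open>1 \<le> i < p\<close>, the truncated sum \<open>\<Sum>\<^sub>n t_n(y)\<close>, \<open>n < p\<close>, is a polynomial in \<open>y\<close> of degree less than \<open>p\<close>
  whose values at the \<open>p\<close> points \<open>(2M+1)^2\<close>, \<open>M < p\<close>, are therefore known. Lagrange interpolation at
  \<open>y = 0\<close> gives the exact formula
  \[ \sum_{n<p} t_n(0) = \sum_{M<p} \frac{4 (1/2)_p^2}{(p-1-M)!\,(p+M)!}
     \prod_{i=1}^{p-1} \Bigl(1 - \frac{(2M+1)^2}{16 i^2}\Bigr). \]
  The term \<open>M = (p-1)/2\<close> is \<open>p (-1)^M\<close> modulo \<open>p\<^sup>4\<close>. All other terms are divisible by \<open>p\<^sup>3\<close>, and modulo
  \<open>p\<^sup>4\<close> they add up to \<open>-p\<^sup>3 \<sigma>\<close> with \<open>\<sigma> = 2 \<Sum>\<^sub>k (-1)^k / (2k+1)^2\<close>, \<open>k < (p-1)/2\<close>. Fermat's theorem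
  turns \<open>\<sigma>\<close> into an alternating sum of powers \<open>(2k+1)^{p-3}\<close>, hence into \<open>E_{p-3}\<close> modulo \<open>p\<close>.
\<close>

section \<open>The terminating deformed sums\<close>

text \<open>Only \<open>v = - (2 M + 1) / 4\<close> is needed in the end, but the sum obeys a first-order recurrence in \<open>M\<close>
  only if \<open>v\<close> is kept fixed.\<close>

definition hyp_term :: "'a::field_char_0 \<Rightarrow> nat \<Rightarrow> nat \<Rightarrow> 'a" where
  "hyp_term v M n = (6 * of_nat n + 2 * of_nat M + 4 * v + 2) *
     (pochhammer (1/2) n * pochhammer (- of_nat M) n * pochhammer (of_nat M + 1) n) /
     (4 ^ n * fact n * pochhammer (v + of_nat M + 3/2) n * pochhammer (1 + v) n)"

text \<open>If either expression vanished, \<open>2 * v\<close> would be an integer. These are the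
  factors of the two Pochhammer symbols with parameter \<open>v\<close> in the denominator of
  \<open>hyp_term\<close>, so nothing divides by zero below.\<close>

lemma half_integer_shift_nonzero:
  fixes v :: "'a::field_char_0"
  assumes "2 * v \<notin> \<int>"
  shows "v + of_nat a + 3/2 + of_nat b \<noteq> 0" "1 + v + of_nat b \<noteq> 0"
proof -
  have "2 * v = of_int (- (2 * int a + 3 + 2 * int b))" if "v + of_nat a + 3/2 + of_nat b = 0"
  proof -
    have "2 * v = 2 * (v + of_nat a + 3/2 + of_nat b) - (2 * of_nat a + 3 + 2 * of_nat b)"
      by (simp add: algebra_simps)
    then show ?thesis unfolding that by simp
  qed
  then show "v + of_nat a + 3/2 + of_nat b \<noteq> 0" using assms by (metis Ints_of_int)
  have "2 * v = of_int (- (2 + 2 * int b))" if "1 + v + of_nat b = 0"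
  proof -
    have "2 * v = 2 * (1 + v + of_nat b) - (2 + 2 * of_nat b)"
      by (simp add: algebra_simps)
    then show ?thesis unfolding that by simp
  qed
  then show "1 + v + of_nat b \<noteq> 0" using assms by (metis Ints_of_int)
qed

text \<open>The Wilf-Zeilberger step in summed form: the right-hand side is the certificate, and its
  increment from \<open>N\<close> to \<open>Suc N\<close> is the new summand on the left. The factor
  \<open>\<rho> M\<close> is the quotient of the closed forms for \<open>Suc M\<close> and
  \<open>M\<close>.\<close>

lemma hyp_term_telescope:
  fixes v :: "'a::field_char_0"
  assumes "2 * v \<notin> \<int>"
  defines "\<rho> \<equiv> \<lambda>M::nat. (v + of_nat M + 3/2) / (1 + v + of_nat M)"
  shows "(\<Sum>n\<le>N. hyp_term v (Suc M) n - \<rho> M * hyp_term v M n) =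
    2 * \<rho> M * (pochhammer (1/2) (Suc N) * pochhammer (- of_nat M) N * pochhammer (of_nat M + 1) (Suc N)) /
      (4 ^ N * fact N * pochhammer (v + of_nat M + 3/2) (Suc N) * pochhammer (1 + v) N)"
proof (induction N)
  case 0
  define B where "B = v + of_nat M + 3/2"
  define C where "C = 1 + v + of_nat M"
  have nz: "B \<noteq> 0" "C \<noteq> 0"
    using half_integer_shift_nonzero(1)[OF assms(1), of M 0] half_integer_shift_nonzero(2)[OF assms(1), of M]
    by (auto simp: B_def C_def)
  have rel: "B = C + 1/2" "v = C - 1 - of_nat M"
    by (simp_all add: B_def C_def)
  have "(2 * of_nat M + 4 * v + 4) - B / C * (2 * of_nat M + 4 * v + 2) = 2 * (B / C) * (1/2 * (of_nat M + 1)) / B"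
    using nz by (simp add: divide_simps) (simp add: rel field_simps)
  then show ?case
    by (simp add: hyp_term_def \<rho>_def B_def C_def algebra_simps)
next
  case (Suc N)
  define B where "B = v + of_nat M + 3/2"
  define C where "C = 1 + v + of_nat M"
  define m where "m = (of_nat M :: 'a)"
  define k where "k = (of_nat N :: 'a)"
  \<comment> \<open>The right-hand side at \<open>N\<close> is \<open>2 * \<rho> M * X\<close>. The
    facts \<open>T1\<close>, \<open>T2\<close> and \<open>R\<close> below write both new terms and
    the right-hand side at \<open>Suc N\<close> as \<open>X\<close> times a rational function, so
    that all Pochhammer symbols drop out.\<close>
  define X where "X = pochhammer (1/2) (Suc N) * pochhammer (- m) N * pochhammer (m + 1) (Suc N) /
      (4 ^ N * fact N * pochhammer B (Suc N) * pochhammer (1 + v) N)"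
  have nz: "B \<noteq> 0" "C \<noteq> 0" "B + k + 1 \<noteq> 0" "1 + v + k \<noteq> 0" "k + 1 \<noteq> 0" "m + 1 \<noteq> 0"
    using half_integer_shift_nonzero(1)[OF assms(1), of M 0] half_integer_shift_nonzero(2)[OF assms(1), of M]
      half_integer_shift_nonzero(1)[OF assms(1), of M "Suc N"] half_integer_shift_nonzero(2)[OF assms(1), of N]
      of_nat_neq_0[of N, where 'a='a] of_nat_neq_0[of M, where 'a='a]
    by (auto simp: B_def C_def k_def m_def algebra_simps)
  have PB: "pochhammer B (Suc N) \<noteq> 0"
    using half_integer_shift_nonzero(1)[OF assms(1), of M]
    by (auto simp: pochhammer_prod B_def)
  have PV: "pochhammer (1 + v) N \<noteq> 0"
    using half_integer_shift_nonzero(2)[OF assms(1)]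
    by (auto simp: pochhammer_prod)
  have e: "pochhammer (- m) (Suc N) = pochhammer (- m) N * (k - m)"
    "pochhammer (1 + v) (Suc N) = pochhammer (1 + v) N * (1 + v + k)"
    "(4::'a) ^ Suc N = 4 * 4 ^ N" "(fact (Suc N) :: 'a) = (k + 1) * fact N"
    "pochhammer (1/2) (Suc (Suc N)) = pochhammer (1/2) (Suc N) * (k + 3/2 :: 'a)"
    "pochhammer (m + 1) (Suc (Suc N)) = pochhammer (m + 1) (Suc N) * (m + k + 2)"
    "pochhammer B (Suc (Suc N)) = pochhammer B (Suc N) * (B + k + 1)"
    "(of_nat (Suc N) :: 'a) = k + 1" "(of_nat (Suc M) :: 'a) = m + 1"
    using pochhammer_Suc[of "1/2 :: 'a" "Suc N"] pochhammer_Suc[of "m + 1" "Suc N"]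
      pochhammer_Suc[of B "Suc N"] pochhammer_Suc[of "- m" N] pochhammer_Suc[of "1 + v" N]
    by (simp_all add: k_def m_def add_ac)
  have Bm: "v + m + 3/2 = B" by (simp add: B_def m_def)
  have T1: "hyp_term v M (Suc N) = (6 * k + 6 + 2 * m + 4 * v + 2) * X * (k - m) / (4 * (k + 1) * (1 + v + k))"
    unfolding hyp_term_def X_def m_def[symmetric] Bm e
    by (simp add: mult_ac)
  \<comment> \<open>Passing from \<open>M\<close> to \<open>Suc M\<close> shifts three parameters by
    one; splitting off the first factor instead of the last returns each symbol to its counterpart
    in \<open>X\<close>.\<close>
  have a: "pochhammer (- (m + 1)) (Suc N) = - (m + 1) * pochhammer (- m) N"
    by (simp add: pochhammer_rec)
  have b: "pochhammer (m + 1 + 1) (Suc N) = pochhammer (m + 1) (Suc N) * (m + k + 2) / (m + 1)"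
    using pochhammer_rec[of "m + 1" "Suc N"] nz(6) unfolding e by (simp add: field_simps)
  have c: "pochhammer (v + (m + 1) + 3/2) (Suc N) = pochhammer B (Suc N) * (B + k + 1) / B"
  proof -
    have "v + (m + 1) + 3/2 = B + 1" by (simp add: B_def m_def)
    then show ?thesis using pochhammer_rec[of B "Suc N"] nz(1) unfolding e by (simp add: field_simps)
  qed
  have T2: "hyp_term v (Suc M) (Suc N) = (6 * k + 6 + 2 * m + 2 + 4 * v + 2) * X * (- (m + k + 2)) * B /
      ((B + k + 1) * (4 * (k + 1) * (1 + v + k)))"
  proof -
    have *: "q * (- (m + 1) * u) * (w * (m + k + 2) / (m + 1)) = - (q * u * w * (m + k + 2))" for q u w
      using nz(6) by (simp add: divide_simps) (simp add: algebra_simps)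
    have gen: "l * (- (x * y)) / (4 * q * (r * f) * (b * E / B) * (w * D)) = l * (x / (q * f * b * w)) * (- y) * B / (E * (4 * r * D))"
      for l x y q r f b E w D :: 'a
      by (simp add: mult_ac)
    have lin: "6 * (k + 1) + 2 * (m + 1) + 4 * v + 2 = 6 * k + 6 + 2 * m + 2 + 4 * v + 2"
      by simp
    show ?thesis
      unfolding hyp_term_def e a b c X_def * gen lin ..
  qed
  have R: "2 * \<rho> M * (pochhammer (1/2) (Suc (Suc N)) * pochhammer (- of_nat M) (Suc N) * pochhammer (of_nat M + 1) (Suc (Suc N))) /
      (4 ^ Suc N * fact (Suc N) * pochhammer (v + of_nat M + 3/2) (Suc (Suc N)) * pochhammer (1 + v) (Suc N))
     = 2 * \<rho> M * X * ((k + 3/2) * (k - m) * (m + k + 2)) / (4 * (k + 1) * (B + k + 1) * (1 + v + k))"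
  proof -
    have gen: "2 * g * (a * h * (b * z) * (c * y)) / (4 * q * (r * f) * (b' * E) * (w * D)) =
      2 * g * (a * b * c / (q * f * b' * w)) * (h * z * y) / (4 * r * E * D)"
      for g a h b z c y q r f b' E w D :: 'a
      by (simp add: mult_ac)
    show ?thesis
      unfolding X_def m_def[symmetric] Bm e gen ..
  qed
  have key: "2 * \<rho> M * X + ((6 * k + 6 + 2 * m + 2 + 4 * v + 2) * X * (- (m + k + 2)) * B /
      ((B + k + 1) * (4 * (k + 1) * (1 + v + k))) - \<rho> M * ((6 * k + 6 + 2 * m + 4 * v + 2) * X * (k - m) / (4 * (k + 1) * (1 + v + k))))
    = 2 * \<rho> M * X * ((k + 3/2) * (k - m) * (m + k + 2)) / (4 * (k + 1) * (B + k + 1) * (1 + v + k))"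
  proof -
    have r: "\<rho> M = B / C" by (simp add: \<rho>_def B_def C_def)
    have v: "v = C - 1 - m" "B = C + 1/2" by (simp_all add: C_def B_def m_def)
    define d where "d = 1 + v + k"
    define E where "E = B + k + 1"
    define r where "r = k + 1"
    have nd: "d \<noteq> 0" "E \<noteq> 0" "r \<noteq> 0" using nz by (auto simp: d_def E_def r_def)
    have gen: "2 * C' * X + (L1 * X * (- y) * B / (E * (4 * r * d)) - C' * (L2 * X * z / (4 * r * d)))
        = 2 * C' * X * (h * z * y) / (4 * r * E * d)"
      if "8 * r * d * E - L1 * y * C - L2 * z * E = 2 * h * z * y" and B: "B = C' * C"
      for C' L1 L2 y z h
    proof -
      have "2 * C' * X + (L1 * X * (- y) * B / (E * (4 * r * d)) - C' * (L2 * X * z / (4 * r * d)))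
        = C' * X * (8 * r * d * E - L1 * y * C - L2 * z * E) / (4 * r * d * E)"
        unfolding B using nd by (simp add: divide_simps) (simp add: algebra_simps)
      then show ?thesis unfolding that by (simp add: mult_ac)
    qed
    \<comment> \<open>The certificate equation with denominators cleared: a polynomial identity in
      \<open>k\<close>, \<open>m\<close> and \<open>C\<close>.\<close>
    have poly: "8 * (k + 1) * (1 + v + k) * (B + k + 1) - (6 * k + 6 + 2 * m + 2 + 4 * v + 2) * (m + k + 2) * C
       - (6 * k + 6 + 2 * m + 4 * v + 2) * (k - m) * (B + k + 1) = 2 * (k + 3/2) * (k - m) * (m + k + 2)"
      unfolding v by (simp add: algebra_simps)
    show ?thesis
      unfolding r using gen[unfolded d_def E_def r_def, OF poly, of "B / C"] nz by simp
  qed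
  show ?case
    unfolding sum.atMost_Suc Suc.IH T1 T2 R
    using key unfolding X_def B_def m_def by simp
qed

text \<open>Summands with n > M vanish because of \<open>pochhammer (- of_nat M) n\<close>, so every
  \<open>N\<close> above \<open>M\<close> gives the complete sum. For M = 0 only n = 0 survives; the
  telescoped identity then yields a first-order recurrence in \<open>M\<close> that the closed form
  satisfies.\<close>

lemma sum_hyp_term:
  fixes v :: "'a::field_char_0"
  assumes v: "2 * v \<notin> \<int>" and "M < N"
  shows "(\<Sum>n<N. hyp_term v M n) = (4 * v + 2) * pochhammer (v + 3/2) M / pochhammer (1 + v) M"
  using \<open>M < N\<close>
proof (induction M)
  case 0
  have "hyp_term v 0 n = (if n = 0 then 4 * v + 2 else 0)" for n
    by (simp add: hyp_term_def pochhammer_0_left)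
  then show ?case using 0 by simp
next
  case (Suc M)
  define \<rho> where "\<rho> = (v + of_nat M + 3/2) / (1 + v + of_nat M)"
  \<comment> \<open>The certificate at the last index \<open>N'\<close> contains
    \<open>pochhammer (- of_nat M) N'\<close>, which is zero because \<open>M < N'\<close>.\<close>
  obtain N' where N: "N = Suc N'" "M < N'" using Suc.prems by (cases N) auto
  have "(\<Sum>n<N. hyp_term v (Suc M) n - \<rho> * hyp_term v M n) = 0"
    using hyp_term_telescope[OF v, of M N'] N
    by (simp add: \<rho>_def lessThan_Suc_atMost pochhammer_of_nat_eq_0_lemma)
  then have "(\<Sum>n<N. hyp_term v (Suc M) n) = \<rho> * (\<Sum>n<N. hyp_term v M n)"
    by (simp add: sum_subtractf sum_distrib_left)
  then show ?case
    using Suc by (simp add: \<rho>_def pochhammer_Suc ac_simps)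
qed

section \<open>The deformed summand, its value at 0 and its sums at odd squares\<close>

definition deformed_term :: "'a::field_char_0 \<Rightarrow> nat \<Rightarrow> 'a" where
  "deformed_term y n = of_nat (6 * n + 1) * pochhammer (1/2) n / fact n *
     (\<Prod>j<n. ((2 * of_nat j + 1)\<^sup>2 - y) / (16 * (of_nat j + 1)\<^sup>2 - y))"

lemma pochhammer_half: "pochhammer (1/2 :: 'a::field_char_0) n / fact n = of_nat ((2 * n) choose n) / 4 ^ n"
proof -
  have "of_nat ((2 * n) choose n) = (fact (2 * n) :: 'a) / (fact n * fact n)"
    by (simp add: binomial_fact mult_2)
  then have "of_nat ((2 * n) choose n) = 4 ^ n * pochhammer (1/2) n / (fact n :: 'a)"
    by (simp add: fact_double power_mult)
  then show ?thesis by simp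
qed

text \<open>At y = 0 the j-th factor is a quarter of the square of (1/2 + j) / (j + 1), so the
  product is the square of (1/2)_n / n! divided by 4^n. With the Pochhammer quotient in front this
  makes three central binomials over 4^n, and 4^(3n) * 4^n = 256^n.\<close>

lemma deformed_term_0:
  "deformed_term (0::'a::field_char_0) n = of_nat (6 * n + 1) / 256 ^ n * of_nat ((2 * n) choose n) ^ 3"
proof -
  have "(\<Prod>j<n. (2 * of_nat j + 1)\<^sup>2 / (16 * (of_nat j + 1)\<^sup>2 :: 'a)) = (pochhammer (1/2) n / fact n)\<^sup>2 / 4 ^ n"
  proof (induction n)
    case (Suc n)
    have "(2 * of_nat n + 1)\<^sup>2 / (16 * (of_nat n + 1)\<^sup>2 :: 'a) = ((1/2 + of_nat n) / (of_nat n + 1))\<^sup>2 / 4"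
    proof -
      have "(1/2 + of_nat n :: 'a) = (2 * of_nat n + 1) / 2" by (simp add: field_simps)
      show ?thesis unfolding \<open>1/2 + of_nat n = _\<close> by (simp only: power_divide) simp
    qed
    then show ?case
      using Suc by (simp add: pochhammer_Suc power_mult_distrib power_divide add_ac mult_ac)
  qed simp
  moreover have "(256::'a) ^ n = 4 ^ n * (4 ^ n)\<^sup>2 * 4 ^ n"
    by (simp add: power2_eq_square flip: power_mult_distrib)
  ultimately show ?thesis
    unfolding deformed_term_def pochhammer_half times_divide_eq_right[symmetric]
    by (simp add: pochhammer_half power3_eq_cube power2_eq_square mult_ac)
qed

text \<open>Numerators and denominators are differences of squares here, and each splits into two
  linear factors in j. The choice of \<open>v\<close> matches the denominators and reduces the
  linear factor of \<open>hyp_term\<close> to 6n + 1.\<close>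

lemma deformed_term_node:
  "deformed_term ((2 * of_nat M + 1)\<^sup>2 :: 'a::field_char_0) n = hyp_term (- (2 * of_nat M + 1) / 4) M n"
proof -
  define v :: 'a where "v = - (2 * of_nat M + 1) / 4"
  have "((2 * of_nat j + 1)\<^sup>2 - (2 * of_nat M + 1)\<^sup>2) / (16 * (of_nat j + 1)\<^sup>2 - (2 * of_nat M + 1)\<^sup>2) =
    (- of_nat M + of_nat j) * (of_nat M + 1 + of_nat j) / (4 * ((v + of_nat M + 3/2 + of_nat j) * (1 + v + of_nat j)))" for j
  proof -
    have "((2 * of_nat j + 1)\<^sup>2 - (2 * of_nat M + 1)\<^sup>2 :: 'a) = 4 * ((- of_nat M + of_nat j) * (of_nat M + 1 + of_nat j))"
      by (simp add: power2_eq_square algebra_simps)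
    moreover have "16 * (of_nat j + 1)\<^sup>2 - (2 * of_nat M + 1)\<^sup>2 = 4 * (4 * ((v + of_nat M + 3/2 + of_nat j) * (1 + v + of_nat j)))"
      by (simp add: v_def power2_eq_square field_simps)
    ultimately show ?thesis by simp
  qed
  then have "(\<Prod>j<n. ((2 * of_nat j + 1)\<^sup>2 - (2 * of_nat M + 1)\<^sup>2) / (16 * (of_nat j + 1)\<^sup>2 - (2 * of_nat M + 1)\<^sup>2)) =
    pochhammer (- of_nat M) n * pochhammer (of_nat M + 1) n /
      (4 ^ n * (pochhammer (v + of_nat M + 3/2) n * pochhammer (1 + v) n))"
    by (simp add: prod_dividef prod.distrib pochhammer_prod atLeast0LessThan)
  moreover have "6 * of_nat n + 2 * of_nat M + 4 * v + 2 = of_nat (6 * n + 1)"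
    by (simp add: v_def field_simps)
  ultimately show ?thesis
    unfolding deformed_term_def hyp_term_def v_def[symmetric] by (simp add: mult_ac)
qed

text \<open>Since \<open>4 * v\<close> is an odd integer, \<open>sum_hyp_term\<close> applies. For
  this \<open>v\<close>, reversing the factors of \<open>pochhammer (1 + v) M\<close> gives
  \<open>pochhammer (v + 1/2) M\<close> up to the sign (-1)^M, and this cancels against the
  numerator except for the factor 2M + 1.\<close>

lemma sum_deformed_term_node:
  assumes "M < N"
  shows "(\<Sum>n<N. deformed_term ((2 * of_nat M + 1)\<^sup>2 :: 'a::field_char_0) n) = (-1) ^ M * (2 * of_nat M + 1)"
proof -
  define v :: 'a where "v = - (2 * of_nat M + 1) / 4"
  have v: "2 * v \<notin> \<int>"
  proof
    assume "2 * v \<in> \<int>"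
    then obtain z where "2 * v = of_int z" by (elim Ints_cases)
    moreover have "2 * (2 * v) = - (2 * of_nat M + 1)" by (simp add: v_def)
    ultimately have "of_int (2 * z) = (of_int (- (2 * int M + 1)) :: 'a)" by simp
    then have "2 * z = - (2 * int M + 1)" by (simp only: of_int_eq_iff)
    then show False by presburger
  qed
  have "pochhammer (1 + v) M \<noteq> 0"
    using half_integer_shift_nonzero(2)[OF v] by (auto simp: pochhammer_prod)
  moreover have "pochhammer (1 + v) M = (-1) ^ M * pochhammer (v + 1/2) M"
    using pochhammer_minus[of "- (1 + v)" M] by (simp add: v_def field_simps)
  moreover have "(4 * v + 2) * pochhammer (v + 3/2) M = pochhammer (v + 1/2) M * (2 * of_nat M + 1)"
  proof -
    have "(v + 1/2) * pochhammer (v + 3/2) M = pochhammer (v + 1/2) M * (v + 1/2 + of_nat M)"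
      using pochhammer_rec[of "v + 1/2" M] pochhammer_Suc[of "v + 1/2" M] by (simp add: add_ac)
    then show ?thesis by (simp add: v_def field_simps)
  qed
  ultimately have "(\<Sum>n<N. hyp_term v M n) = (2 * of_nat M + 1) / (-1) ^ M"
    using sum_hyp_term[OF v assms] by simp
  then show ?thesis
    unfolding deformed_term_node v_def[symmetric] by (simp add: divide_inverse mult.commute flip: power_inverse)
qed

section \<open>Interpolation\<close>

lemma lagrange_interpolation:
  fixes P :: "'a::field poly"
  assumes "finite A" "degree P < card A"
  shows "poly P x = (\<Sum>a\<in>A. poly P a * (\<Prod>b\<in>A - {a}. (x - b) / (a - b)))"
proof -
  define L where "L = (\<lambda>a. \<Prod>b\<in>A - {a}. smult (inverse (a - b)) [:- b, 1:])"
  define Q where "Q = (\<Sum>a\<in>A. smult (poly P a) (L a))"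
  have L: "poly (L a) x = (\<Prod>b\<in>A - {a}. (x - b) / (a - b))" for a x
    unfolding L_def poly_prod by (intro prod.cong) (simp_all add: divide_inverse algebra_simps)
  have "degree (L a) \<le> card A - 1" if "a \<in> A" for a
  proof -
    have "degree (L a) \<le> (\<Sum>b\<in>A - {a}. degree (smult (inverse (a - b)) [:- b, 1:]))"
      unfolding L_def using assms(1) by (intro order.trans[OF degree_prod_sum_le]) (auto simp: o_def)
    also have "\<dots> \<le> (\<Sum>b\<in>A - {a}. 1)"
      by (intro sum_mono) (simp add: degree_smult_eq)
    also have "\<dots> = card A - 1" using that assms by simp
    finally show ?thesis .
  qed
  then have "degree Q \<le> card A - 1"
    unfolding Q_def by (intro degree_sum_le assms) (auto intro: order.trans[OF degree_smult_le])
  then have "degree Q < card A" using assms(2) by simp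
  moreover have "poly P z = poly Q z" if "z \<in> A" for z
  proof -
    have "poly (L a) z = (if a = z then 1 else 0)" if "a \<in> A" for a
    proof (cases "a = z")
      case True
      show ?thesis unfolding L True by (simp, intro prod.neutral) auto
    next
      case False
      then show ?thesis unfolding L using \<open>z \<in> A\<close> assms(1) by (auto simp: prod_zero_iff)
    qed
    then have "poly Q z = (\<Sum>a\<in>A. if a = z then poly P a else 0)"
      unfolding Q_def poly_sum by (intro sum.cong) auto
    then show ?thesis using that assms(1) by simp
  qed
  ultimately have "P = Q" using assms by (intro poly_eqI_degree[of A]) auto
  then have "poly P x = poly Q x" by simp
  then show ?thesis by (simp add: Q_def poly_sum L)
qed

text \<open>The product is the Lagrange coefficient at 0 of the node (2M+1)^2, and the second factor
  is the value of the truncated sum there. Differences of odd squares factor as 4(K-M)(K+M+1), so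
  the products are factorials; the sign from the K below \<open>M\<close> cancels (-1)^M.\<close>

lemma node_weight:
  assumes "M < N"
  shows "(\<Prod>K\<in>{..<N} - {M}. (2 * of_nat K + 1)\<^sup>2 / ((2 * of_nat K + 1)\<^sup>2 - (2 * of_nat M + 1)\<^sup>2)) *
      ((-1) ^ M * (2 * of_nat M + 1)) =
    4 * (pochhammer (1/2) N)\<^sup>2 / (fact (N - 1 - M) * fact (N + M) :: 'a::field_char_0)"
proof -
  have quot: "(2 * of_nat K + 1)\<^sup>2 / ((2 * of_nat K + 1)\<^sup>2 - (2 * of_nat M + 1)\<^sup>2 :: 'a) =
      (1/2 + of_nat K)\<^sup>2 / ((- of_nat M + of_nat K) * (of_nat M + 1 + of_nat K))" for K
  proof -
    have "(2 * of_nat K + 1)\<^sup>2 - (2 * of_nat M + 1)\<^sup>2 = (4 * ((- of_nat M + of_nat K) * (of_nat M + 1 + of_nat K)) :: 'a)"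
      by (simp add: power2_eq_square algebra_simps)
    moreover have "(2 * of_nat K + 1)\<^sup>2 = (4 * (1/2 + of_nat K)\<^sup>2 :: 'a)"
      by (simp add: power2_eq_square field_simps)
    ultimately show ?thesis by simp
  qed
  show ?thesis
    using Suc_leI[OF assms] unfolding quot
  \<comment> \<open>Starting at \<open>Suc M\<close> leaves only K < M in the base case; each step
    then adds the single factor K = N.\<close>
  proof (induction N rule: dec_induct)
    case base
    have "{..<Suc M} - {M} = {..<M}" by auto
    moreover have "(\<Prod>K<M. (- of_nat M + of_nat K :: 'a)) = (-1) ^ M * fact M"
      using pochhammer_same[of M, where 'a='a] by (simp add: pochhammer_prod atLeast0LessThan)
    moreover have "(\<Prod>K<M. (of_nat M + 1 + of_nat K :: 'a)) = fact (M + M) / fact M"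
    proof -
      have "fact (M + M) = fact M * pochhammer (of_nat M + 1 :: 'a) M"
        using pochhammer_product'[of "1::'a" M M] by (simp add: pochhammer_fact add.commute)
      then show ?thesis by (simp add: pochhammer_prod atLeast0LessThan)
    qed
    moreover have "(\<Prod>K<M. (1/2 + of_nat K :: 'a)\<^sup>2) = (pochhammer (1/2) M)\<^sup>2"
      by (simp add: pochhammer_prod atLeast0LessThan prod_power_distrib)
    moreover have "4 * (pochhammer (1/2) (Suc M))\<^sup>2 = (pochhammer (1/2) M)\<^sup>2 * (2 * of_nat M + 1 :: 'a)\<^sup>2"
      by (simp add: pochhammer_Suc power2_eq_square field_simps)
    moreover have "fact (Suc M + M) = (2 * of_nat M + 1) * (fact (M + M) :: 'a)"
    proof -
      have "of_nat (Suc (M + M)) = (2 * of_nat M + 1 :: 'a)" by simp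
      then show ?thesis by (metis add_Suc fact_Suc)
    qed
    moreover have "(2 * of_nat M + 1 :: 'a) \<noteq> 0"
      using of_nat_neq_0[of "2 * M", where 'a='a] by (simp add: add.commute)
    moreover have "P\<^sup>2 / (e * f * (F / f)) * (e * w) = 4 * Q\<^sup>2 / (fact (Suc M - 1 - M) * (w * F))"
      if "4 * Q\<^sup>2 = P\<^sup>2 * w\<^sup>2" "w \<noteq> 0" "e \<noteq> 0" "f \<noteq> 0" for P Q w e f F :: 'a
      unfolding that(1) using that(2-) by (simp add: power2_eq_square)
    ultimately show ?case
      by (simp add: prod_dividef prod.distrib del: fact_Suc)
  next
    case (step N)
    have ins: "{..<Suc N} - {M} = insert N ({..<N} - {M})" using step.hyps by auto
    then have "(\<Prod>K\<in>{..<Suc N} - {M}. (1/2 + of_nat K :: 'a)\<^sup>2 / ((- of_nat M + of_nat K) * (of_nat M + 1 + of_nat K))) *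
       ((-1) ^ M * (2 * of_nat M + 1)) = (1/2 + of_nat N)\<^sup>2 / ((- of_nat M + of_nat N) * (of_nat M + 1 + of_nat N)) *
       (4 * (pochhammer (1/2) N)\<^sup>2 / (fact (N - 1 - M) * fact (N + M)))"
      using step.IH by (simp add: mult.assoc)
    moreover have "fact (Suc N - 1 - M) = ((- of_nat M + of_nat N) * fact (N - 1 - M) :: 'a)"
    proof -
      have "Suc N - 1 - M = Suc (N - 1 - M)" "of_nat (Suc (N - 1 - M)) = (- of_nat M + of_nat N :: 'a)"
        using step.hyps by (auto simp: of_nat_diff)
      then show ?thesis by (metis fact_Suc)
    qed
    moreover have "fact (Suc N + M) = ((of_nat M + 1 + of_nat N) * fact (N + M) :: 'a)"
      by (simp add: add_ac)
    ultimately show ?case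
      by (simp add: pochhammer_Suc power_mult_distrib mult_ac del: fact_Suc)
  qed
qed


text \<open>The sum is multiplied by a common denominator \<open>D\<close>, interpolated at the odd
  squares and divided by \<open>D 0\<close>. The quotient of \<open>D\<close> at a node by
  \<open>D 0\<close> is the product in the statement.\<close>

lemma sum_deformed_term_0:
  assumes "N > 0"
  shows "(\<Sum>n<N. deformed_term (0::'a::field_char_0) n) =
    (\<Sum>M<N. 4 * (pochhammer (1/2) N)\<^sup>2 / (fact (N - 1 - M) * fact (N + M)) *
      (\<Prod>i=1..<N. 1 - (2 * of_nat M + 1)\<^sup>2 / (16 * (of_nat i)\<^sup>2)))"
proof -
  \<comment> \<open>This is \<open>D\<close> times the truncated sum after cancellation. Term n
    keeps n factors from its numerator and N - 1 - n uncancelled factors of \<open>D\<close>, so the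
    degree is below the number \<open>N\<close> of nodes.\<close>
  define Q :: "'a poly" where "Q = (\<Sum>n<N. smult (of_nat (6 * n + 1) * pochhammer (1/2) n / fact n)
    ((\<Prod>j<n. [:(2 * of_nat j + 1)\<^sup>2, -1:]) * (\<Prod>j=n..<N-1. [:16 * (of_nat j + 1)\<^sup>2, -1:])))"
  \<comment> \<open>The last term, n = N - 1, involves only j < N - 1, so these factors suffice as a
    common denominator.\<close>
  define D :: "'a \<Rightarrow> 'a" where "D = (\<lambda>y. \<Prod>j<N-1. 16 * (of_nat j + 1)\<^sup>2 - y)"
  define y :: "nat \<Rightarrow> 'a" where "y = (\<lambda>M. (2 * of_nat M + 1)\<^sup>2)"
  have Q: "poly Q x = D x * (\<Sum>n<N. deformed_term x n)" if "D x \<noteq> 0" for x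
  proof -
    have "poly Q x = (\<Sum>n<N. of_nat (6 * n + 1) * pochhammer (1/2) n / fact n *
      ((\<Prod>j<n. (2 * of_nat j + 1)\<^sup>2 - x) * (\<Prod>j=n..<N-1. 16 * (of_nat j + 1)\<^sup>2 - x)))"
      by (simp add: Q_def poly_sum poly_prod)
    also have "\<dots> = (\<Sum>n<N. D x * deformed_term x n)"
    proof (intro sum.cong refl)
      fix n assume "n \<in> {..<N}"
      then have D: "D x = (\<Prod>j<n. 16 * (of_nat j + 1)\<^sup>2 - x) * (\<Prod>j=n..<N-1. 16 * (of_nat j + 1)\<^sup>2 - x)"
        unfolding D_def lessThan_atLeast0 by (intro prod.atLeastLessThan_concat[symmetric]) auto
      with that have "(\<Prod>j<n. 16 * (of_nat j + 1)\<^sup>2 - x) \<noteq> 0" by auto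
      then show "of_nat (6 * n + 1) * pochhammer (1/2) n / fact n *
          ((\<Prod>j<n. (2 * of_nat j + 1)\<^sup>2 - x) * (\<Prod>j=n..<N-1. 16 * (of_nat j + 1)\<^sup>2 - x)) =
        D x * deformed_term x n"
        unfolding D deformed_term_def prod_dividef by simp
    qed
    finally show ?thesis by (simp add: sum_distrib_left)
  qed
  have "degree ((\<Prod>j<n. [:(2 * of_nat j + 1)\<^sup>2, -1:]) * (\<Prod>j=n..<N-1. [:16 * (of_nat j + 1)\<^sup>2, -1 :: 'a:])) \<le> N - 1"
    if "n < N" for n
  proof -
    have "degree (\<Prod>j<n. [:(2 * of_nat j + 1)\<^sup>2, -1 :: 'a:]) \<le> n"
      by (intro order.trans[OF degree_prod_sum_le]) (auto simp: o_def)
    moreover have "degree (\<Prod>j=n..<N-1. [:16 * (of_nat j + 1)\<^sup>2, -1 :: 'a:]) \<le> N - 1 - n"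
      by (intro order.trans[OF degree_prod_sum_le]) (auto simp: o_def)
    ultimately show ?thesis using that by (intro order.trans[OF degree_mult_le]) linarith
  qed
  then have degQ: "degree Q \<le> N - 1"
    unfolding Q_def by (intro degree_sum_le) (auto intro: order.trans[OF degree_smult_le])
  have inj: "inj_on y {..<N}"
  proof (rule inj_onI)
    fix a b assume "y a = y b"
    then have "of_nat ((2 * a + 1)\<^sup>2) = (of_nat ((2 * b + 1)\<^sup>2) :: 'a)" by (simp add: y_def add.commute)
    then have "(2 * a + 1)\<^sup>2 = (2 * b + 1)\<^sup>2" by (simp only: of_nat_eq_iff)
    then show "a = b" by simp
  qed
  have D0: "D 0 \<noteq> 0"
    unfolding D_def using of_nat_neq_0[where 'a='a] by (auto simp: add.commute)
  \<comment> \<open>The zeros of \<open>D\<close> are even integers and the nodes are odd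
    squares.\<close>
  have Dy: "D (y M) \<noteq> 0" for M
  proof -
    have "16 * (of_nat j + 1)\<^sup>2 \<noteq> y M" for j
    proof
      assume "16 * (of_nat j + 1)\<^sup>2 = y M"
      then have "of_nat (16 * (j + 1)\<^sup>2) = (of_nat ((2 * M + 1)\<^sup>2) :: 'a)" by (simp add: y_def add.commute)
      then have "16 * (j + 1)\<^sup>2 = (2 * M + 1)\<^sup>2" by (simp only: of_nat_eq_iff)
      moreover have "odd ((2 * M + 1)\<^sup>2)" by simp
      ultimately show False by (metis dvd_mult2 even_numeral)
    qed
    then show ?thesis by (auto simp: D_def)
  qed
  have "D 0 * (\<Sum>n<N. deformed_term 0 n) = poly Q 0" using Q[OF D0] by simp
  also have "\<dots> = (\<Sum>a\<in>y ` {..<N}. poly Q a * (\<Prod>b\<in>y ` {..<N} - {a}. (0 - b) / (a - b)))"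
    using degQ assms by (intro lagrange_interpolation) (auto simp: card_image[OF inj])
  also have "\<dots> = (\<Sum>M<N. poly Q (y M) * (\<Prod>K\<in>{..<N} - {M}. y K / (y K - y M)))"
    unfolding sum.reindex[OF inj] o_def
  proof (intro sum.cong refl arg_cong2[where f = "(*)"])
    fix M assume M: "M \<in> {..<N}"
    have "y ` {..<N} - {y M} = y ` ({..<N} - {M})"
      using inj M by (auto dest: inj_onD)
    moreover have "inj_on y ({..<N} - {M})" using inj by (rule inj_on_subset) auto
    ultimately show "(\<Prod>b\<in>y ` {..<N} - {y M}. (0 - b) / (y M - b)) = (\<Prod>K\<in>{..<N} - {M}. y K / (y K - y M))"
      by (simp add: prod.reindex minus_divide_right)
  qed
  also have "\<dots> = (\<Sum>M<N. D (y M) * (4 * (pochhammer (1/2) N)\<^sup>2 / (fact (N - 1 - M) * fact (N + M))))"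
  proof (intro sum.cong refl)
    fix M assume "M \<in> {..<N}"
    then have "M < N" by simp
    show "poly Q (y M) * (\<Prod>K\<in>{..<N} - {M}. y K / (y K - y M)) = D (y M) * (4 * (pochhammer (1/2) N)\<^sup>2 / (fact (N - 1 - M) * fact (N + M)))"
      unfolding Q[OF Dy] node_weight[OF \<open>M < N\<close>, symmetric]
      unfolding y_def sum_deformed_term_node[OF \<open>M < N\<close>] by (simp only: mult_ac)
  qed
  finally have "(\<Sum>n<N. deformed_term 0 n) =
      (\<Sum>M<N. D (y M) * (4 * (pochhammer (1/2) N)\<^sup>2 / (fact (N - 1 - M) * fact (N + M)))) / D 0"
    using D0 by (simp add: field_simps)
  then have main: "(\<Sum>n<N. deformed_term 0 n) =
      (\<Sum>M<N. 4 * (pochhammer (1/2) N)\<^sup>2 / (fact (N - 1 - M) * fact (N + M)) * (D (y M) / D 0))"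
    by (simp add: sum_divide_distrib mult.commute)
  have "D (y M) / D 0 = (\<Prod>i=1..<N. 1 - (2 * of_nat M + 1)\<^sup>2 / (16 * (of_nat i)\<^sup>2))" for M
  proof -
    have "D (y M) / D 0 = (\<Prod>j<N-1. 1 - (2 * of_nat M + 1)\<^sup>2 / (16 * (of_nat (Suc j))\<^sup>2))"
      unfolding D_def y_def prod_dividef[symmetric]
    proof (intro prod.cong refl)
      fix j
      have "(of_nat j + 1 :: 'a) \<noteq> 0" using of_nat_neq_0[of j, where 'a='a] by (simp add: add.commute)
      then show "(16 * (of_nat j + 1)\<^sup>2 - (2 * of_nat M + 1)\<^sup>2) / (16 * (of_nat j + 1)\<^sup>2 - 0) =
        1 - (2 * of_nat M + 1)\<^sup>2 / (16 * (of_nat (Suc j) :: 'a)\<^sup>2)"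
        by (simp add: diff_divide_distrib add.commute)
    qed
    also have "\<dots> = (\<Prod>i=Suc 0..<Suc (N-1). 1 - (2 * of_nat M + 1)\<^sup>2 / (16 * (of_nat i)\<^sup>2))"
      by (simp only: prod.shift_bounds_Suc_ivl lessThan_atLeast0)
    finally show ?thesis using assms by simp
  qed
  then show ?thesis unfolding main by simp
qed

section \<open>Congruences between rationals\<close>

text \<open>Membership in the localization of the integers at p, phrased through
  \<open>quotient_of\<close> to agree with the condition in \<open>rat_cong\<close>.\<close>

definition p_integral :: "nat \<Rightarrow> rat \<Rightarrow> bool" where
  "p_integral p x \<longleftrightarrow> \<not> int p dvd snd (quotient_of x)"

lemma rat_cong_iff: "rat_cong x y p k \<longleftrightarrow> (\<exists>c. p_integral p c \<and> x - y = of_nat p ^ k * c)"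
  by (auto simp: rat_cong_def p_integral_def)

text \<open>The denominator in lowest terms divides every other denominator. Any representation as a
  fraction may thus be used, and closure under arithmetic follows without reducing
  fractions.\<close>

lemma p_integral_iff:
  assumes "prime p"
  shows "p_integral p x \<longleftrightarrow> (\<exists>a b. x = of_int a / of_int b \<and> \<not> int p dvd b)"
proof
  assume "p_integral p x"
  then show "\<exists>a b. x = of_int a / of_int b \<and> \<not> int p dvd b"
    unfolding p_integral_def by (metis prod.collapse quotient_of_div)
next
  assume "\<exists>a b. x = of_int a / of_int b \<and> \<not> int p dvd b"
  then obtain a b where x: "x = of_int a / of_int b" and b: "\<not> int p dvd b" by blast
  obtain c d where q: "quotient_of x = (c, d)" by force
  have "b \<noteq> 0" using b by auto
  moreover have "d > 0" using q by (rule quotient_of_denom_pos)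
  moreover have "x = of_int c / of_int d" using q by (rule quotient_of_div)
  ultimately have "(of_int (c * b) :: rat) = of_int (a * d)"
    using x by (simp add: field_simps)
  then have "d dvd c * b" by (simp only: of_int_eq_iff) simp
  moreover have "coprime c d" using q by (rule quotient_of_coprime)
  ultimately have "d dvd b" by (simp add: coprime_commute coprime_dvd_mult_right_iff)
  then show "p_integral p x" using b q by (auto simp: p_integral_def)
qed

context
  fixes p :: nat
  assumes p: "prime p"
begin

lemma p_integral_divide_int:
  assumes "p_integral p x" "\<not> int p dvd b"
  shows "p_integral p (x / of_int b)"
proof -
  obtain c d where "x = of_int c / of_int d" "\<not> int p dvd d"
    using assms p_integral_iff[OF p] by blast
  then have "x / of_int b = of_int c / of_int (d * b) \<and> \<not> int p dvd d * b"
    using assms p by (simp add: prime_dvd_mult_iff)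
  then show ?thesis using p_integral_iff[OF p] by blast
qed

lemma p_integral_of_int [simp]: "p_integral p (of_int a)"
proof -
  have "(of_int a :: rat) = of_int a / of_int 1 \<and> \<not> int p dvd 1" using p by (auto simp: prime_gt_1_nat)
  then show ?thesis using p_integral_iff[OF p] by blast
qed

lemma p_integral_of_nat [simp]: "p_integral p (of_nat a)"
  using p_integral_of_int[of "int a"] by simp

lemma p_integral_numeral [simp]: "p_integral p (numeral a)" "p_integral p 0" "p_integral p 1"
  using p_integral_of_int[of "numeral a"] p_integral_of_int[of 0] p_integral_of_int[of 1] by simp_all

lemma p_integral_mult [simp]:
  assumes "p_integral p x" "p_integral p y"
  shows "p_integral p (x * y)"
proof -
  obtain a b c d where "x = of_int a / of_int b" "\<not> int p dvd b" "y = of_int c / of_int d" "\<not> int p dvd d"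
    using assms p_integral_iff[OF p] by metis
  then have "x * y = of_int (a * c) / of_int (b * d) \<and> \<not> int p dvd b * d"
    using p by (simp add: prime_dvd_mult_iff)
  then show ?thesis using p_integral_iff[OF p] by blast
qed

lemma p_integral_add [simp]:
  assumes "p_integral p x" "p_integral p y"
  shows "p_integral p (x + y)"
proof -
  obtain a b c d where "x = of_int a / of_int b" "\<not> int p dvd b" "y = of_int c / of_int d" "\<not> int p dvd d"
    using assms p_integral_iff[OF p] by metis
  moreover from this have "b \<noteq> 0" "d \<noteq> 0" by auto
  ultimately have "x + y = of_int (a * d + c * b) / of_int (b * d) \<and> \<not> int p dvd b * d"
    using p by (simp add: prime_dvd_mult_iff field_simps)
  then show ?thesis using p_integral_iff[OF p] by blast
qed

lemma p_integral_uminus [simp]: "p_integral p x \<Longrightarrow> p_integral p (- x)"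
  using p_integral_mult[OF p_integral_of_int[of "-1"]] by simp

lemma p_integral_diff [simp]: "p_integral p x \<Longrightarrow> p_integral p y \<Longrightarrow> p_integral p (x - y)"
  using p_integral_add[of x "- y"] by simp

lemma p_integral_power [simp]: "p_integral p x \<Longrightarrow> p_integral p (x ^ n)"
  by (induction n) simp_all

lemma p_integral_sum [simp]: "(\<And>i. i \<in> I \<Longrightarrow> p_integral p (f i)) \<Longrightarrow> p_integral p (sum f I)"
  by (induction I rule: infinite_finite_induct) simp_all

lemma rat_cong_refl [simp]: "rat_cong x x p k"
  unfolding rat_cong_iff by (rule exI[of _ 0]) simp

lemma rat_cong_sym: "rat_cong x y p k \<Longrightarrow> rat_cong y x p k"
  unfolding rat_cong_iff by (metis minus_diff_eq mult_minus_right p_integral_uminus)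

lemma rat_cong_add:
  assumes "rat_cong x y p k" "rat_cong x' y' p k"
  shows "rat_cong (x + x') (y + y') p k"
proof -
  obtain c c' where "p_integral p c" "x - y = of_nat p ^ k * c" "p_integral p c'" "x' - y' = of_nat p ^ k * c'"
    using assms unfolding rat_cong_iff by blast
  then have "p_integral p (c + c') \<and> (x + x') - (y + y') = of_nat p ^ k * (c + c')"
    by (simp add: algebra_simps)
  then show ?thesis unfolding rat_cong_iff by blast
qed

lemma rat_cong_trans: "rat_cong x y p k \<Longrightarrow> rat_cong y z p k \<Longrightarrow> rat_cong x z p k"
  using rat_cong_add[of x y k y z] by (simp add: rat_cong_def algebra_simps)

lemma rat_cong_mult_left:
  assumes "rat_cong x y p k" "p_integral p z"
  shows "rat_cong (z * x) (z * y) p k"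
proof -
  obtain c where "p_integral p c" "x - y = of_nat p ^ k * c"
    using assms unfolding rat_cong_iff by blast
  then have "p_integral p (z * c) \<and> z * x - z * y = of_nat p ^ k * (z * c)"
    using assms(2) by (simp add: right_diff_distrib[symmetric])
  then show ?thesis unfolding rat_cong_iff by blast
qed

text \<open>The difference splits as x'(x - y) + y(x' - y'), hence the integrality conditions on
  \<open>y\<close> and \<open>x'\<close>.\<close>

lemma rat_cong_mult:
  assumes "rat_cong x y p k" "rat_cong x' y' p k" "p_integral p y" "p_integral p x'"
  shows "rat_cong (x * x') (y * y') p k"
  using rat_cong_trans[OF rat_cong_mult_left[OF assms(1,4)], of "y * y'"] rat_cong_mult_left[OF assms(2,3)]
  by (simp add: mult.commute)

lemma rat_cong_sum: "(\<And>i. i \<in> I \<Longrightarrow> rat_cong (f i) (g i) p k) \<Longrightarrow> rat_cong (sum f I) (sum g I) p k"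
  by (induction I rule: infinite_finite_induct) (simp_all add: rat_cong_add)

lemma rat_cong_mult_power: "rat_cong x y p k \<Longrightarrow> rat_cong (of_nat p ^ j * x) (of_nat p ^ j * y) p (j + k)"
  unfolding rat_cong_iff by (auto simp: power_add right_diff_distrib[symmetric] mult.assoc)

lemma rat_cong_weaken:
  assumes "rat_cong x y p k" "j \<le> k"
  shows "rat_cong x y p j"
proof -
  obtain c where c: "p_integral p c" "x - y = of_nat p ^ k * c"
    using assms unfolding rat_cong_iff by blast
  have "x - y = of_nat p ^ j * (of_nat p ^ (k - j) * c)"
    using assms(2) unfolding c(2) mult.assoc[symmetric] power_add[symmetric] by simp
  moreover have "p_integral p (of_nat p ^ (k - j) * c)" using c(1) by simp
  ultimately show ?thesis unfolding rat_cong_iff by blast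
qed

text \<open>The bridge from integer congruences to fractions: the difference has numerator a d - c b
  over the denominator b d, which is prime to p.\<close>

lemma rat_cong_divide_int:
  assumes "[a * d = c * b] (mod int p)" "\<not> int p dvd b" "\<not> int p dvd d"
  shows "rat_cong (of_int a / of_int b) (of_int c / of_int d) p 1"
proof -
  obtain k where k: "a * d - c * b = int p * k"
    using assms(1) by (auto simp: cong_iff_dvd_diff)
  have nz: "b \<noteq> 0" "d \<noteq> 0" using assms by auto
  have "of_int a / of_int b - of_int c / (of_int d :: rat) = of_int (a * d - c * b) / of_int (b * d)"
    using nz by (simp add: field_simps)
  also have "\<dots> = of_nat p ^ 1 * (of_int k / of_int (b * d))"
    unfolding k by simp
  finally have "of_int a / of_int b - of_int c / (of_int d :: rat) = of_nat p ^ 1 * (of_int k / of_int (b * d))" .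
  moreover have "p_integral p (of_int k / of_int (b * d))"
    using assms p by (intro p_integral_divide_int) (simp_all add: prime_dvd_mult_iff)
  ultimately show ?thesis unfolding rat_cong_iff by blast
qed

lemma rat_cong_of_int: "[a = b] (mod int p) \<Longrightarrow> rat_cong (of_int a) (of_int b) p 1"
  using rat_cong_divide_int[of a 1 b 1] prime_gt_1_nat[OF p] by simp

text \<open>Writing x = 1 + p a / b with \<open>b\<close> prime to p, the numerator b + p a is also
  prime to p, so x is a unit of the localization.\<close>

lemma p_integral_inverse:
  assumes "rat_cong x 1 p 1"
  shows "p_integral p (inverse x)" "x \<noteq> 0"
proof -
  obtain c where c: "p_integral p c" "x - 1 = of_nat p * c"
    using assms unfolding rat_cong_iff by auto
  obtain a b where ab: "c = of_int a / of_int b" "\<not> int p dvd b"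
    using c(1) p_integral_iff[OF p] by blast
  have "b \<noteq> 0" using ab by auto
  have x: "x = of_int (b + int p * a) / of_int b"
    using c(2) \<open>b \<noteq> 0\<close> unfolding ab by (simp add: field_simps)
  have nd: "\<not> int p dvd b + int p * a" using ab(2) by (simp add: dvd_add_left_iff)
  then show "x \<noteq> 0" using x \<open>b \<noteq> 0\<close> by (metis divide_eq_0_iff dvd_0_right of_int_eq_0_iff)
  have "inverse x = of_int b / of_int (b + int p * a)" unfolding x by simp
  then show "p_integral p (inverse x)" using p_integral_divide_int[OF _ nd, of "of_int b"] by simp
qed

section \<open>Inverse squares modulo p\<close>

lemma p_integral_inverse_square: "\<not> p dvd i \<Longrightarrow> p_integral p (1 / (of_nat i)\<^sup>2)"
  using p_integral_divide_int[of 1 "(int i)\<^sup>2"] p by (simp add: prime_dvd_power_iff)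

text \<open>The indices are negatives of each other modulo p, so their squares agree. The case n = 1
  serves the reflection of 1, ..., p - 1, the case n = 2 the pairs of odd numbers with sum
  2p.\<close>

lemma inverse_square_reflect:
  assumes "i + j = n * p" "\<not> p dvd i"
  shows "rat_cong (1 / (of_nat i)\<^sup>2) (1 / (of_nat j)\<^sup>2) p 1"
proof -
  have "\<not> p dvd j" using assms by (metis dvd_add_left_iff dvd_triv_right)
  have "int i = int n * int p - int j" using arg_cong[OF assms(1), of int] by simp
  then have "[int i = - int j] (mod int p)" by (simp add: cong_iff_dvd_diff)
  then have "[(int i)\<^sup>2 = (- int j)\<^sup>2] (mod int p)" by (rule cong_pow)
  then have "[1 * (int j)\<^sup>2 = 1 * (int i)\<^sup>2] (mod int p)" by (simp add: cong_sym)
  then have "rat_cong (of_int 1 / of_int ((int i)\<^sup>2)) (of_int 1 / of_int ((int j)\<^sup>2)) p 1"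
    using \<open>\<not> p dvd i\<close> \<open>\<not> p dvd j\<close> p by (intro rat_cong_divide_int) (simp_all add: prime_dvd_power_iff)
  then show ?thesis by simp
qed

text \<open>Expanding gives 1 - p^2 (sum of the c) modulo p^3, and divisibility of that sum by p
  removes the quadratic term.\<close>

lemma prod_one_minus_cong:
  assumes "finite I" "\<And>i. i \<in> I \<Longrightarrow> p_integral p (c i)" "rat_cong (sum c I) 0 p 1"
  shows "rat_cong (\<Prod>i\<in>I. 1 - of_nat p ^ 2 * c i) 1 p 3"
proof -
  have "\<exists>e. p_integral p e \<and> (\<Prod>i\<in>I. 1 - of_nat p ^ 2 * c i) = 1 - of_nat p ^ 2 * sum c I + of_nat p ^ 3 * e"
    using assms(1,2)
  proof (induction I rule: finite_induct)
    case empty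
    show ?case by (rule exI[of _ 0]) simp
  next
    case (insert i I)
    then obtain e where e: "p_integral p e"
      "(\<Prod>i\<in>I. 1 - of_nat p ^ 2 * c i) = 1 - of_nat p ^ 2 * sum c I + of_nat p ^ 3 * e" by auto
    have "p_integral p (e + of_nat p * c i * sum c I - of_nat p ^ 2 * c i * e)"
      using e insert.prems by simp
    moreover have "(\<Prod>i\<in>insert i I. 1 - of_nat p ^ 2 * c i) = 1 - of_nat p ^ 2 * sum c (insert i I) +
        of_nat p ^ 3 * (e + of_nat p * c i * sum c I - of_nat p ^ 2 * c i * e)"
      using insert.hyps by (simp add: e(2)) (simp add: algebra_simps power2_eq_square power3_eq_cube)
    ultimately show ?case by blast
  qed
  then obtain e where e: "p_integral p e"
    "(\<Prod>i\<in>I. 1 - of_nat p ^ 2 * c i) = 1 - of_nat p ^ 2 * sum c I + of_nat p ^ 3 * e" by blast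
  obtain d where d: "p_integral p d" "sum c I = of_nat p * d"
    using assms(3) unfolding rat_cong_iff by auto
  have "(\<Prod>i\<in>I. 1 - of_nat p ^ 2 * c i) - 1 = of_nat p ^ 3 * (e - d)"
    unfolding e(2) d(2) by (simp add: algebra_simps power2_eq_square power3_eq_cube)
  then show ?thesis unfolding rat_cong_iff using e(1) d(1) by (metis p_integral_diff)
qed

text \<open>If \<open>H\<close> and \<open>T\<close> are the first two sums, the reflection \<open>i \<mapsto> p - i\<close> gives \<open>T \<equiv> 2 H\<close>; as it also exchanges odd
  and even numbers, \<open>T \<equiv> 2 (H / 4)\<close>. So \<open>3 H / 2 \<equiv> 0\<close>, and this is where \<open>p > 3\<close> is needed.\<close>

lemma sums_inverse_squares:
  assumes "p > 3" "p = 2 * m + 1"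
  shows "rat_cong (\<Sum>i=1..m. 1 / (of_nat i)\<^sup>2) 0 p 1"
    and "rat_cong (\<Sum>i=1..<p. 1 / (of_nat i)\<^sup>2) 0 p 1"
    and "rat_cong (\<Sum>M<m. 1 / (of_nat (2 * M + 1))\<^sup>2) 0 p 1"
proof -
  define f :: "nat \<Rightarrow> rat" where "f = (\<lambda>i. 1 / (of_nat i)\<^sup>2)"
  define H T U where "H = sum f {1..m}" and "T = sum f {1..<p}" and "U = (\<Sum>M<m. f (2 * M + 1))"
  have ndvd: "\<not> p dvd i" if "0 < i" "i < p" for i using that nat_dvd_not_less by blast
  have "T = H + sum f {Suc m..<p}"
    unfolding T_def H_def atLeastLessThanSuc_atLeastAtMost[symmetric]
    by (rule sum.atLeastLessThan_concat[symmetric]) (use assms(2) in auto)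
  moreover have "sum f {Suc m..<p} = (\<Sum>i=1..m. f (p - i))"
    by (rule sum.reindex_bij_witness[of _ "\<lambda>i. p - i" "\<lambda>i. p - i"]) (use assms(2) in auto)
  moreover have "rat_cong (\<Sum>i=1..m. f (p - i)) H p 1"
    unfolding H_def f_def by (intro rat_cong_sum inverse_square_reflect[where n = 1] ndvd) (use assms(2) in auto)
  ultimately have T1: "rat_cong T (2 * H) p 1"
    by (simp only: mult_2 rat_cong_add rat_cong_refl)
  have "T = (\<Sum>j=1..m. f (2 * j)) + U"
  proof -
    have "{1..<p} = (\<lambda>j. 2 * j) ` {1..m} \<union> (\<lambda>M. 2 * M + 1) ` {..<m}"
    proof (intro equalityI subsetI)
      fix x assume x: "x \<in> {1..<p}"
      show "x \<in> (\<lambda>j. 2 * j) ` {1..m} \<union> (\<lambda>M. 2 * M + 1) ` {..<m}"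
      proof (cases "even x")
        case True
        then obtain j where "x = 2 * j" by blast
        then show ?thesis using x assms(2) by auto
      next
        case False
        then obtain j where "x = 2 * j + 1" by (rule oddE)
        then show ?thesis using x assms(2) by auto
      qed
    qed (use assms(2) in auto)
    then have "T = sum f ((\<lambda>j. 2 * j) ` {1..m} \<union> (\<lambda>M. 2 * M + 1) ` {..<m})"
      by (simp only: T_def)
    also have "\<dots> = sum f ((\<lambda>j. 2 * j) ` {1..m}) + sum f ((\<lambda>M. 2 * M + 1) ` {..<m})"
      by (intro sum.union_disjoint) (auto, presburger)
    finally show ?thesis by (simp add: sum.reindex inj_on_def U_def)
  qed
  moreover have "(\<Sum>j=1..m. f (2 * j)) = H / 4"
    by (simp add: f_def H_def sum_divide_distrib power_mult_distrib mult.commute)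
  moreover have U1: "rat_cong U (H / 4) p 1"
  proof -
    \<comment> \<open>Reflection sends the odd number 2M + 1 to p - (2M + 1) = 2(m - M).\<close>
    have "rat_cong U (\<Sum>M<m. f (2 * (m - M))) p 1"
      unfolding U_def f_def by (intro rat_cong_sum inverse_square_reflect[where n = 1] ndvd) (use assms(2) in auto)
    also have "(\<Sum>M<m. f (2 * (m - M))) = (\<Sum>j=1..m. f (2 * j))"
      by (rule sum.reindex_bij_witness[of _ "\<lambda>i. m - i" "\<lambda>i. m - i"]) auto
    also have "\<dots> = H / 4" by fact
    finally show ?thesis .
  qed
  ultimately have T2: "rat_cong T (H / 4 + H / 4) p 1"
    by (simp only: rat_cong_add rat_cong_refl)
  have "rat_cong (2 * H) (H / 4 + H / 4) p 1"
    using rat_cong_trans[OF rat_cong_sym[OF T1] T2] .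
  then have "rat_cong (2 * H - (H / 4 + H / 4)) 0 p 1"
    by (simp add: rat_cong_def)
  moreover have "p_integral p (2 / of_int 3)"
    using assms(1) p by (intro p_integral_divide_int) (auto simp: prime_nat_iff dest!: zdvd_imp_le)
  ultimately have "rat_cong (2 / of_int 3 * (2 * H - (H / 4 + H / 4))) (2 / of_int 3 * 0) p 1"
    by (intro rat_cong_mult_left)
  then have H0: "rat_cong H 0 p 1" by (simp add: field_simps)
  then show "rat_cong (\<Sum>i=1..m. 1 / (of_nat i)\<^sup>2) 0 p 1" by (simp add: H_def f_def)
  show "rat_cong (\<Sum>i=1..<p. 1 / (of_nat i)\<^sup>2) 0 p 1"
    using rat_cong_trans[OF T1, of 0] rat_cong_mult_left[OF H0, of 2] by (simp add: T_def f_def)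
  have "\<not> int p dvd 4"
  proof
    assume "int p dvd 4"
    then have "int p \<le> 4" by (rule zdvd_imp_le) simp
    then show False using assms by presburger
  qed
  then have "p_integral p (1 / of_int 4)"
    by (intro p_integral_divide_int p_integral_numeral)
  then have "rat_cong (1 / of_int 4 * H) (1 / of_int 4 * 0) p 1"
    by (intro rat_cong_mult_left H0)
  then have "rat_cong (H / 4) 0 p 1" by simp
  then show "rat_cong (\<Sum>M<m. 1 / (of_nat (2 * M + 1))\<^sup>2) 0 p 1"
    using rat_cong_trans[OF U1, of 0] unfolding U_def f_def by blast
qed

end

section \<open>Euler numbers\<close>

text \<open>Umbrally, (E + 1)^n + (E - 1)^n is 2 for n = 0 and 0 otherwise. The bracket doubles the
  terms with n - i even and kills the rest; what remains is the defining recursion with E_n itself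
  as the summand k = 0.\<close>

lemma euler_num_odd_even_sum:
  "(\<Sum>i\<le>n. int (n choose i) * euler_num i * (1 + (-1) ^ (n - i))) = (if n = 0 then 2 else 0)"
proof (cases "n = 0")
  case True
  then show ?thesis by (simp add: euler_num.simps)
next
  case False
  have "(\<Sum>i\<le>n. int (n choose i) * euler_num i * (1 + (-1) ^ (n - i))) =
      (\<Sum>j\<le>n. int (n choose j) * euler_num (n - j) * (1 + (-1) ^ j))"
    by (rule sum.reindex_bij_witness[of _ "\<lambda>i. n - i" "\<lambda>i. n - i"]) (auto simp: binomial_symmetric[symmetric])
  also have "\<dots> = (\<Sum>j\<in>(\<lambda>k. 2 * k) ` {0..n div 2}. int (n choose j) * euler_num (n - j) * (1 + (-1) ^ j))"
  proof (intro sum.mono_neutral_right)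
    show "\<forall>j\<in>{..n} - (\<lambda>k. 2 * k) ` {0..n div 2}. int (n choose j) * euler_num (n - j) * (1 + (-1) ^ j) = 0"
    proof
      fix j assume j: "j \<in> {..n} - (\<lambda>k. 2 * k) ` {0..n div 2}"
      have "odd j"
      proof
        assume "even j"
        then obtain k where "j = 2 * k" by blast
        then show False using j by auto
      qed
      then show "int (n choose j) * euler_num (n - j) * (1 + (-1) ^ j) = 0" by simp
    qed
  qed auto
  also have "\<dots> = 2 * (\<Sum>k=0..n div 2. int (n choose (2 * k)) * euler_num (n - 2 * k))"
    by (simp add: sum.reindex inj_on_def sum_distrib_left mult_ac)
  also have "(\<Sum>k=0..n div 2. int (n choose (2 * k)) * euler_num (n - 2 * k)) = 0"
    using False by (simp add: sum.atLeast_Suc_atMost euler_num.simps[of n])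
  finally show ?thesis using False by simp
qed

text \<open>In the usual notation \<open>euler_appell n x\<close> is \<open>2^n E_n((x+1)/2)\<close>.\<close>

definition euler_appell :: "nat \<Rightarrow> int \<Rightarrow> int" where
  "euler_appell n x = (\<Sum>i\<le>n. int (n choose i) * euler_num i * x ^ (n - i))"

text \<open>The Taylor expansion of an Appell sequence. After expanding the power binomially, the
  coefficient is the trinomial one, symmetric in i and l, so the sums can be exchanged.\<close>

lemma euler_appell_add:
  "euler_appell n (x + y) = (\<Sum>l\<le>n. int (n choose l) * x ^ l * euler_appell (n - l) y)"
proof -
  have "euler_appell n (x + y) =
      (\<Sum>i\<le>n. \<Sum>l\<le>n - i. int (n choose i) * euler_num i * (int ((n - i) choose l) * x ^ l * y ^ (n - i - l)))"
    by (simp add: euler_appell_def binomial_ring sum_distrib_left)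
  also have "\<dots> = (\<Sum>l\<le>n. \<Sum>i\<le>n - l. int (n choose i) * euler_num i * (int ((n - i) choose l) * x ^ l * y ^ (n - i - l)))"
    unfolding sum.Sigma[OF finite_atMost ballI[OF finite_atMost]]
    by (rule sum.reindex_bij_witness[of _ "\<lambda>(i, l). (l, i)" "\<lambda>(i, l). (l, i)"]) auto
  also have "\<dots> = (\<Sum>l\<le>n. int (n choose l) * x ^ l * euler_appell (n - l) y)"
    unfolding euler_appell_def sum_distrib_left
  proof (intro sum.cong refl)
    fix l i assume "l \<in> {..n}" "i \<in> {..n - l}"
    then have "i + l \<le> n" by auto
    have "(n choose i) * ((n - i) choose l) = (n choose l) * ((n - l) choose i)"
    proof -
      have "(n choose (i + l)) * ((i + l) choose i) = (n choose i) * ((n - i) choose l)"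
        using choose_mult[of i "i + l" n] \<open>i + l \<le> n\<close> by simp
      moreover have "(n choose (i + l)) * ((i + l) choose l) = (n choose l) * ((n - l) choose i)"
        using choose_mult[of l "i + l" n] \<open>i + l \<le> n\<close> by simp
      moreover have "(i + l) choose i = (i + l) choose l"
        using binomial_symmetric[of i "i + l"] by simp
      ultimately show ?thesis by simp
    qed
    then have "int (n choose i) * int ((n - i) choose l) = int (n choose l) * int ((n - l) choose i)"
      by (metis of_nat_mult)
    moreover have "n - i - l = n - l - i" by simp
    ultimately show "int (n choose i) * euler_num i * (int ((n - i) choose l) * x ^ l * y ^ (n - i - l)) =
      int (n choose l) * x ^ l * (int ((n - l) choose i) * euler_num i * y ^ (n - l - i))"
      by (simp add: mult_ac)
  qed
  finally show ?thesis .
qed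

text \<open>In the expansions with increments 1 and -1 all coefficients cancel by
  \<open>euler_num_odd_even_sum\<close>, except for l = n.\<close>

lemma euler_appell_functional: "euler_appell n (x + 1) + euler_appell n (x - 1) = 2 * x ^ n"
proof -
  have "euler_appell k 1 + euler_appell k (-1) = (if k = 0 then 2 else 0)" for k
    using euler_num_odd_even_sum[of k] by (simp add: euler_appell_def sum.distrib algebra_simps)
  then have "euler_appell n (x + 1) + euler_appell n (x + -1) =
      (\<Sum>l\<le>n. int (n choose l) * x ^ l * (if n - l = 0 then 2 else 0))"
    unfolding euler_appell_add by (simp add: sum.distrib[symmetric] distrib_left[symmetric])
  also have "\<dots> = (\<Sum>l\<le>n. if l = n then 2 * x ^ n else 0)"
    by (intro sum.cong) auto
  finally show ?thesis by simp
qed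

text \<open>The functional equation at the odd number 2N + 1 makes the alternating sum telescope
  over even arguments.\<close>

lemma alternating_odd_power_sum:
  "2 * (\<Sum>k<N. (-1) ^ k * (2 * int k + 1) ^ n) = euler_appell n 0 - (-1) ^ N * euler_appell n (2 * int N)"
proof (induction N)
  case (Suc N)
  have step: "2 * (2 * int N + 1) ^ n = euler_appell n (2 * int (Suc N)) + euler_appell n (2 * int N)"
    using euler_appell_functional[of n "2 * int N + 1"] by (simp add: algebra_simps)
  have "2 * (\<Sum>k<Suc N. (-1) ^ k * (2 * int k + 1) ^ n) =
      2 * (\<Sum>k<N. (-1) ^ k * (2 * int k + 1) ^ n) + (-1) ^ N * (2 * (2 * int N + 1) ^ n)"
    by (simp add: algebra_simps)
  then show ?case unfolding Suc.IH step by (simp add: algebra_simps del: of_nat_Suc)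
qed simp

lemma euler_appell_0: "euler_appell n 0 = euler_num n"
proof -
  have "euler_appell n 0 = (\<Sum>i\<le>n. if i = n then euler_num n else 0)"
    unfolding euler_appell_def by (intro sum.cong) (auto simp: power_0_left)
  then show ?thesis by simp
qed

text \<open>With N = p odd, the telescoped sum is
  \<open>euler_appell n 0 + euler_appell n (2 * int p)\<close>. Both terms are congruent to E_n, and
  the factor 2 is invertible.\<close>

lemma euler_num_cong_sum:
  assumes "odd p"
  shows "[euler_num n = (\<Sum>k<p. (-1) ^ k * (2 * int k + 1) ^ n)] (mod int p)"
proof -
  have "[euler_appell n (2 * int p) = euler_appell n 0] (mod int p)"
    unfolding euler_appell_def by (intro cong_sum cong_mult cong_refl cong_pow) (simp add: cong_def)
  then have "[euler_appell n 0 + euler_appell n (2 * int p) = euler_appell n 0 + euler_appell n 0] (mod int p)"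
    by (intro cong_add cong_refl)
  then have "[euler_appell n 0 + euler_appell n (2 * int p) = 2 * euler_num n] (mod int p)"
    by (simp only: euler_appell_0 mult_2)
  then have "[2 * (\<Sum>k<p. (-1) ^ k * (2 * int k + 1) ^ n) = 2 * euler_num n] (mod int p)"
    using alternating_odd_power_sum[where N = p] assms by simp
  moreover have "coprime 2 (int p)" using assms by simp
  ultimately show ?thesis by (metis cong_mult_lcancel cong_sym)
qed

section \<open>Consequences of Wilson's theorem\<close>

context
  fixes p :: nat
  assumes p: "prime p"
begin

text \<open>As i runs over 0, ..., p - 1, the numbers 4i - c meet every residue once, with the zero
  residue at \<open>i0\<close>. By Wilson's theorem the remaining ones multiply to -1; the factor at
  i = 0 is -c, which explains the \<open>c\<close> in front.\<close>

lemma linear_product_cong: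
  assumes "odd p" "\<not> int p dvd c" "i0 \<in> {1..<p}" "int p dvd 4 * int i0 - c"
  shows "[c * (\<Prod>i\<in>{1..<p} - {i0}. 4 * int i - c) = 1] (mod int p)"
proof -
  define A where "A = {0..<p} - {i0}"
  define f where "f = (\<lambda>i. (4 * int i - c) mod int p)"
  have p0: "p > 0" using p by (simp add: prime_gt_0_nat)
  have cop: "coprime 4 (int p)"
    using assms(1) coprime_power_left_iff[of 2 2 "int p"] by simp
  have eq: "i = j" if "i < p" "j < p" "int p dvd (4 * int i - c) - (4 * int j - c)" for i j
  proof -
    have "int p dvd 4 * (int i - int j)" using that(3) by (simp add: algebra_simps)
    then have "int p dvd int i - int j"
      using cop by (metis coprime_commute coprime_dvd_mult_right_iff)
    then have "[int i = int j] (mod int p)" by (simp add: cong_iff_dvd_diff)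
    then show "i = j" using that by (simp add: cong_int_iff cong_def)
  qed
  have inj: "inj_on f A"
  proof (rule inj_onI)
    fix i j assume "i \<in> A" "j \<in> A" "f i = f j"
    then show "i = j" unfolding f_def A_def by (intro eq) (auto simp: mod_eq_dvd_iff)
  qed
  have "f ` A \<subseteq> {1..int p - 1}"
  proof
    fix x assume "x \<in> f ` A"
    then obtain i where "i \<in> A" and "x = f i" by blast
    then have i: "i < p" "i \<noteq> i0" "x = f i" by (auto simp: A_def)
    have "x \<noteq> 0"
    proof
      assume "x = 0"
      then have "(4 * int i - c) mod int p = 0" unfolding i(3) f_def .
      then have "int p dvd 4 * int i - c" by (rule mod_0_imp_dvd)
      from dvd_diff[OF this assms(4)] have "int p dvd (4 * int i - c) - (4 * int i0 - c)" .
      moreover have "i0 < p" using assms(3) by simp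
      ultimately have "i = i0" using eq i(1) by blast
      with i(2) show False ..
    qed
    moreover have "0 \<le> x" "x < int p" using p0 i by (simp_all add: f_def)
    ultimately show "x \<in> {1..int p - 1}" by simp
  qed
  moreover have "card (f ` A) = card {1..int p - 1}"
    using card_image[OF inj] assms(3) by (simp add: A_def)
  ultimately have img: "f ` A = {1..int p - 1}" by (intro card_subset_eq) auto
  have "(\<Prod>i\<in>A. f i) = \<Prod>{1..int p - 1}"
    using prod.reindex[OF inj, of "\<lambda>x. x"] img by simp
  also have "\<dots> = fact (p - 1)"
  proof -
    have "\<Prod>{1..int p - 1} = (\<Prod>k\<in>{1..p - 1}. int k)"
      by (rule prod.reindex_bij_witness[of _ int nat]) (use p0 in auto)
    then show ?thesis by (simp add: fact_prod)
  qed
  finally have "[(\<Prod>i\<in>A. 4 * int i - c) = fact (p - 1)] (mod int p)"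
    using cong_prod[of A "\<lambda>i. 4 * int i - c" f "int p"] by (simp add: f_def)
  also have "[fact (p - 1) = - 1] (mod int p)" using wilson_theorem[OF p] .
  also have "A = insert 0 ({1..<p} - {i0})" using assms(3) p0 by (auto simp: A_def)
  finally have "[- c * (\<Prod>i\<in>{1..<p} - {i0}. 4 * int i - c) = - 1] (mod int p)" by simp
  then show ?thesis using cong_minus_minus_iff by fastforce
qed

text \<open>Both parts rest on (kp + 1)...(kp + M) being congruent to M!: k = 1 is the second claim.
  For the first, (p-1)! is (p-1-M)! times the top \<open>M\<close> factors, which up to the sign
  (-1)^M are the product for k = -1; Wilson's theorem finishes.\<close>

lemma fact_reflect_cong:
  assumes "M < p"
  shows "[fact (p - 1 - M) * fact M = - ((-1) ^ M)] (mod int p)"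
    and "[pochhammer (int p + 1) M = fact M] (mod int p)"
proof -
  define n where "n = p - 1 - M"
  have shift: "[pochhammer (k * int p + 1) M = fact M] (mod int p)" for k
    unfolding pochhammer_prod fact_prod_Suc of_nat_prod
    by (intro cong_prod) (simp add: cong_iff_dvd_diff)
  show "[pochhammer (int p + 1) M = fact M] (mod int p)"
    using shift[of 1] by simp
  have "fact (p - 1) = fact n * pochhammer (int n + 1) M"
    using pochhammer_product'[of "1 :: int" n M] assms
    by (simp add: pochhammer_fact n_def add.commute)
  also have "pochhammer (int n + 1) M = (-1) ^ M * pochhammer (- 1 * int p + 1) M"
    using pochhammer_minus[of "- (int n + 1)" M] assms by (simp add: n_def of_nat_diff)
  finally have eq: "fact (p - 1) = fact n * ((-1) ^ M * pochhammer (- 1 * int p + 1) M)" .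
  have "[fact n * ((-1) ^ M * fact M) = (fact (p - 1) :: int)] (mod int p)"
    unfolding eq by (intro cong_mult cong_refl cong_sym[OF shift])
  also have "[fact (p - 1) = - 1] (mod int p)" using wilson_theorem[OF p] .
  finally have "[(-1) ^ M * (fact n * ((-1) ^ M * fact M)) = (-1) ^ M * (- 1)] (mod int p)"
    by (intro cong_mult cong_refl)
  moreover have "(-1) ^ M * (fact n * ((-1) ^ M * fact M)) = (fact n * fact M :: int)"
    by (simp add: mult_ac flip: power_add power_mult_distrib)
  ultimately show "[fact (p - 1 - M) * fact M = - ((-1) ^ M)] (mod int p)"
    unfolding n_def by (simp only: mult_minus_right mult_1_right)
qed

end

section \<open>The interpolation terms modulo \<open>p\<^sup>4\<close>\<close>

text \<open>The factors pair up as (j - x)(j + x) = j^2 (1 - x^2 / j^2). With x a multiple of p this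
  shows that only even powers of p occur.\<close>

lemma pochhammer_reflect_prod:
  "pochhammer (1 - x) m * pochhammer (1 + x) m =
    (fact m)\<^sup>2 * (\<Prod>j=1..m. 1 - x\<^sup>2 / (of_nat j :: 'a::field_char_0)\<^sup>2)"
proof (induction m)
  case (Suc m)
  have "(of_nat (Suc m))\<^sup>2 * (1 - x\<^sup>2 / (of_nat (Suc m) :: 'a)\<^sup>2) = (of_nat (Suc m))\<^sup>2 - x\<^sup>2"
    using of_nat_neq_0[of m, where 'a='a] by (simp add: field_simps del: of_nat_Suc)
  also have "\<dots> = (1 - x + of_nat m) * (1 + x + of_nat m)"
    by (simp add: power2_eq_square algebra_simps)
  finally have step: "(1 - x + of_nat m) * (1 + x + of_nat m) = (of_nat (Suc m))\<^sup>2 * (1 - x\<^sup>2 / (of_nat (Suc m) :: 'a)\<^sup>2)" ..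
  have "pochhammer (1 - x) (Suc m) * pochhammer (1 + x) (Suc m) =
      (pochhammer (1 - x) m * pochhammer (1 + x) m) * ((1 - x + of_nat m) * (1 + x + of_nat m))"
    by (simp add: pochhammer_Suc mult_ac)
  also have "\<dots> = (fact (Suc m))\<^sup>2 * (\<Prod>j=1..Suc m. 1 - x\<^sup>2 / (of_nat j)\<^sup>2)"
    unfolding Suc step by (simp add: power_mult_distrib mult_ac del: of_nat_Suc)
  finally show ?case .
qed simp

text \<open>The factors 1/2, 3/2, ..., 2m + 1/2 lie symmetrically about the middle one, x/2, and are
  paired at equal distance j from it.\<close>

lemma pochhammer_half_odd:
  fixes x :: "'a::field_char_0"
  assumes "x = of_nat (2 * m + 1)"
  shows "pochhammer (1/2) (2 * m + 1) = x / 2 * ((-1) ^ m * ((fact m)\<^sup>2 * (\<Prod>j=1..m. 1 - (x / 2)\<^sup>2 / (of_nat j)\<^sup>2)))"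
proof -
  have "pochhammer (1/2) (m + Suc m) = pochhammer (1/2) m * pochhammer (x / 2) (Suc m)"
    unfolding pochhammer_product'[of "1/2" m "Suc m"] assms by (simp add: field_simps)
  also have "pochhammer (1/2) m = (-1) ^ m * pochhammer (1 - x / 2) m"
  proof -
    have "- (1/2) - of_nat m + 1 = 1 - x / 2" by (simp add: assms field_simps)
    then show ?thesis using pochhammer_minus[of "- (1/2) :: 'a" m] by simp
  qed
  also have "pochhammer (x / 2) (Suc m) = x / 2 * pochhammer (1 + x / 2) m"
    by (simp add: pochhammer_rec add.commute)
  finally have "pochhammer (1/2) (m + Suc m) = x / 2 * ((-1) ^ m * (pochhammer (1 - x / 2) m * pochhammer (1 + x / 2) m))"
    by (simp only: mult_ac)
  then show ?thesis unfolding pochhammer_reflect_prod by (simp add: mult_2)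
qed

text \<open>After splitting off m!, the factors m + 1, ..., 3m + 1 lie symmetrically about x = 2m +
  1.\<close>

lemma fact_odd_add:
  fixes x :: "'a::field_char_0"
  assumes "x = of_nat (2 * m + 1)"
  shows "fact ((2 * m + 1) + m) = x * (fact m * ((-1) ^ m * ((fact m)\<^sup>2 * (\<Prod>j=1..m. 1 - x\<^sup>2 / (of_nat j)\<^sup>2))))"
proof -
  have "fact ((2 * m + 1) + m) = (fact (2 * m + 1) * pochhammer (1 + x) m :: 'a)"
    using pochhammer_product'[of "1 :: 'a" "2 * m + 1" m] by (simp add: pochhammer_fact assms)
  also have "fact (2 * m + 1) = x * fact (m + m)"
    unfolding assms using fact_Suc[of "m + m", where 'a='a] by (simp only: mult_2 Suc_eq_plus1)
  also have "fact (m + m) = fact m * pochhammer (of_nat m + 1 :: 'a) m"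
    using pochhammer_product'[of "1::'a" m m] by (simp add: pochhammer_fact add.commute)
  also have "pochhammer (of_nat m + 1) m = (-1) ^ m * pochhammer (1 - x) m"
    using pochhammer_minus[of "- (of_nat m + 1) :: 'a" m] by (simp add: assms algebra_simps)
  finally have "fact ((2 * m + 1) + m) = x * (fact m * ((-1) ^ m * (pochhammer (1 - x) m * pochhammer (1 + x) m)))"
    by (simp only: mult_ac)
  then show ?thesis unfolding pochhammer_reflect_prod .
qed

text \<open>The M-th summand of \<open>sum_deformed_term_0\<close> for N = p.\<close>

definition node_term :: "nat \<Rightarrow> nat \<Rightarrow> rat" where
  "node_term p M = 4 * (pochhammer (1/2) p)\<^sup>2 / (fact (p - 1 - M) * fact (p + M)) *
      (\<Prod>i=1..<p. 1 - (2 * of_nat M + 1)\<^sup>2 / (16 * (of_nat i)\<^sup>2))"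

context
  fixes p m :: nat
  assumes p: "prime p" and p3: "p > 3" and pm: "p = 2 * m + 1"
begin

lemma not_dvd_power_2: "\<not> int p dvd 2 ^ k"
proof
  assume "int p dvd 2 ^ k"
  then have "int p dvd 2" using p by (metis prime_dvd_power prime_nat_int_transfer)
  then have "int p \<le> 2" by (rule zdvd_imp_le) simp
  then show False using p3 by simp
qed

text \<open>The quadratic term is p^2 / 4 times the sum of the inverse squares up to
  \<open>m\<close>, which is divisible by p.\<close>

lemma prod_half_cong:
  "rat_cong (\<Prod>j=1..m. 1 - (of_nat p / 2)\<^sup>2 / (of_nat j)\<^sup>2) 1 p 3"
proof -
  have "\<not> int p dvd 4" using not_dvd_power_2[of 2] by simp
  then have int4: "p_integral p (1 / of_int 4)"
    using p_integral_divide_int[OF p p_integral_numeral(3)[OF p]] by blast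
  have "p_integral p (1 / of_int 4 * (1 / (of_nat j)\<^sup>2))" if "j \<in> {1..m}" for j
    using that p pm int4 by (intro p_integral_mult p_integral_inverse_square) (auto dest: dvd_imp_le)
  moreover have "rat_cong (\<Sum>j=1..m. 1 / of_int 4 * (1 / (of_nat j)\<^sup>2)) 0 p 1"
    using rat_cong_mult_left[OF p sums_inverse_squares(1)[OF p p3 pm] int4]
    by (simp add: sum_distrib_left)
  ultimately have "rat_cong (\<Prod>j=1..m. 1 - of_nat p ^ 2 * (1 / of_int 4 * (1 / (of_nat j)\<^sup>2))) 1 p 3"
    by (intro prod_one_minus_cong p) auto
  then show ?thesis by (simp add: power_divide)
qed

text \<open>Here 2M + 1 = p, and the symmetric products reduce the term to (-1)^m p a^2 g / b. The
  products \<open>a\<close>, \<open>b\<close> and \<open>g\<close> are 1 modulo p^3 because the sums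
  of inverse squares vanish modulo p; the outer factor p raises the modulus to p^4.\<close>

lemma central_node_term: "rat_cong (node_term p m) (of_nat p * (-1) ^ m) p 4"
proof -
  define x :: rat where "x = of_nat p"
  define a b g where "a = (\<Prod>j=1..m. 1 - (x / 2)\<^sup>2 / (of_nat j)\<^sup>2)"
    and "b = (\<Prod>j=1..m. 1 - x\<^sup>2 / (of_nat j)\<^sup>2)"
    and "g = (\<Prod>i=1..<p. 1 - x\<^sup>2 / (16 * (of_nat i)\<^sup>2))"
  have nd: "\<not> p dvd j" if "1 \<le> j" "j < p" for j using that by (auto dest: dvd_imp_le)
  have a: "rat_cong a 1 p 3"
    using prod_half_cong by (simp only: a_def x_def)
  have b: "rat_cong b 1 p 3"
  proof -
    have "rat_cong (\<Prod>j=1..m. 1 - of_nat p ^ 2 * (1 / (of_nat j)\<^sup>2)) 1 p 3"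
      by (intro prod_one_minus_cong p p_integral_inverse_square nd sums_inverse_squares p3 pm) (use pm in auto)
    then show ?thesis by (simp add: b_def x_def)
  qed
  have g: "rat_cong g 1 p 3"
  proof -
    have "\<not> int p dvd 16" using not_dvd_power_2[of 4] by simp
    then have int16: "p_integral p (1 / of_int 16)"
      using p_integral_divide_int[OF p p_integral_numeral(3)[OF p]] by blast
    have "p_integral p (1 / of_int 16 * (1 / (of_nat j)\<^sup>2))" if "j \<in> {1..<p}" for j
      using that p int16 nd by (intro p_integral_mult p_integral_inverse_square) auto
    moreover have "rat_cong (\<Sum>j=1..<p. 1 / of_int 16 * (1 / (of_nat j)\<^sup>2)) 0 p 1"
      using rat_cong_mult_left[OF p sums_inverse_squares(2)[OF p p3 pm] int16]
      by (simp add: sum_distrib_left)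
    ultimately have "rat_cong (\<Prod>j=1..<p. 1 - of_nat p ^ 2 * (1 / of_int 16 * (1 / (of_nat j)\<^sup>2))) 1 p 3"
      by (intro prod_one_minus_cong p) auto
    then show ?thesis by (simp add: g_def x_def)
  qed
  have int: "p_integral p y" if "rat_cong y 1 p 3" for y
  proof -
    obtain c where "p_integral p c" "y - 1 = of_nat p ^ 3 * c" using \<open>rat_cong y 1 p 3\<close> unfolding rat_cong_iff by blast
    then have "y = 1 + of_nat p ^ 3 * c" by simp
    then show ?thesis using \<open>p_integral p c\<close> p by simp
  qed
  have binv: "p_integral p (inverse b)" "b \<noteq> 0"
    using p_integral_inverse[OF p rat_cong_weaken[OF p b, of 1]] by auto
  have "rat_cong (a * a) (1 * 1) p 3"
    using a int[OF a] p by (intro rat_cong_mult) auto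
  then have "rat_cong (a * a * g) (1 * 1 * 1) p 3"
    by (rule rat_cong_mult[OF p _ g]) (use int[OF g] p in auto)
  then have "rat_cong (a * a * g) b p 3"
    using rat_cong_trans[OF p _ rat_cong_sym[OF p b]] by simp
  then have "rat_cong (inverse b * (a * a * g)) (inverse b * b) p 3"
    using binv p by (intro rat_cong_mult_left) auto
  then have "rat_cong (of_nat p ^ 1 * (inverse b * (a * a * g))) (of_nat p ^ 1 * (inverse b * b)) p (1 + 3)"
    using p by (intro rat_cong_mult_power) auto
  then have "rat_cong ((-1) ^ m * (of_nat p ^ 1 * (inverse b * (a * a * g)))) ((-1) ^ m * (of_nat p ^ 1 * (inverse b * b))) p (1 + 3)"
    by (rule rat_cong_mult_left[OF p]) (use p in auto)
  moreover have "node_term p m = (-1) ^ m * (of_nat p ^ 1 * (inverse b * (a * a * g)))"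
  proof -
    have P: "pochhammer (1/2) p = x / 2 * ((-1) ^ m * ((fact m)\<^sup>2 * a))"
      using pochhammer_half_odd[of x m] by (simp add: x_def pm a_def)
    have F: "fact (p + m) = x * (fact m * ((-1) ^ m * ((fact m)\<^sup>2 * b)))"
      using fact_odd_add[of x m] by (simp add: x_def pm b_def del: fact_Suc)
    have G: "(\<Prod>i=1..<p. 1 - (2 * of_nat m + 1)\<^sup>2 / (16 * (of_nat i)\<^sup>2)) = g"
    proof -
      have "2 * of_nat m + 1 = x" by (simp add: x_def pm)
      then show ?thesis by (simp only: g_def)
    qed
    have x0: "x \<noteq> 0" using p by (simp add: x_def prime_gt_0_nat)
    have "p - 1 - m = m" by (simp add: pm)
    then have "node_term p m = 4 * (x / 2 * (s * (f\<^sup>2 * a)))\<^sup>2 / (f * (x * (f * (s * (f\<^sup>2 * b))))) * g"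
      if "s = (-1) ^ m" "f = fact m" for s f
      unfolding node_term_def G P F that by simp
    moreover have "4 * (x / 2 * (s * (f\<^sup>2 * a)))\<^sup>2 / (f * (x * (f * (s * (f\<^sup>2 * b))))) * g = s * (x * (inverse b * (a * a * g)))"
      if "f \<noteq> 0" "s \<noteq> 0" for s f
      using that x0 binv(2) by (simp add: divide_simps power2_eq_square)
    ultimately show ?thesis by (simp add: x_def)
  qed
  ultimately show ?thesis using binv(2) by (simp add: mult.commute)
qed

text \<open>With \<open>c = 2 M + 1\<close>, exactly one of the factors \<open>4 i - c\<close> and one of the factors \<open>4 i + c\<close>, \<open>0 < i < p\<close>,
  is divisible by \<open>p\<close>; their cofactors \<open>e0\<close>, \<open>e1\<close> are the only part of the term that depends on \<open>c\<close>
  through more than its residue class.\<close>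

lemma noncentral_node_term_aux:
  assumes "M < p" "M \<noteq> m" "i0 \<in> {1..<p}" "i1 \<in> {1..<p}"
    and e0: "4 * int i0 - (2 * int M + 1) = e0 * int p" and e1: "4 * int i1 + (2 * int M + 1) = e1 * int p"
  shows "rat_cong (node_term p M) (of_nat p ^ 3 * (- ((-1) ^ M * of_int (e0 * e1)) / (2 * of_nat M + 1)\<^sup>2)) p 4"
proof -
  define c where "c = 2 * int M + 1"
  define x :: rat where "x = of_nat p"
  define a where "a = (\<Prod>j=1..m. 1 - (x / 2)\<^sup>2 / (of_nat j)\<^sup>2)"
  define P0 P1 where "P0 = (\<Prod>i\<in>{1..<p} - {i0}. 4 * int i - c)"
    and "P1 = (\<Prod>i\<in>{1..<p} - {i1}. 4 * int i - (- c))"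
  \<comment> \<open>These are the integers left once p^3 and a^2 are taken out of the term. The
    squared Pochhammer symbol supplies p^2, the factors at \<open>i0\<close> and \<open>i1\<close>
    another p^2, and (p + M)! in the denominator removes one p.\<close>
  define num where "num = e0 * e1 * P0 * P1 * fact m ^ 4"
  define den where "den = 16 ^ (p - 1) * fact (p - 1) ^ 3 * (fact (p - 1 - M) * pochhammer (int p + 1) M)"
  have cp: "\<not> int p dvd c"
  proof
    assume "int p dvd c"
    moreover have "int p dvd 2 * int p" by simp
    ultimately have "int p dvd c - int p" by (simp add: dvd_diff)
    moreover have "c - int p = 2 * (int M - int m)" by (simp add: c_def pm)
    moreover have "coprime (int p) 2" using pm by simp
    ultimately have "int p dvd int M - int m" by (metis coprime_dvd_mult_right_iff)
    then have "[int M = int m] (mod int p)" by (simp add: cong_iff_dvd_diff)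
    then have "M = m" using assms(1) pm by (simp add: cong_int_iff cong_def)
    then show False using assms(2) by simp
  qed
  have PP: "[c\<^sup>2 * (P0 * P1) = - 1] (mod int p)"
  proof -
    have "odd p" using pm by simp
    have "4 * int i0 - c = e0 * int p" "4 * int i1 - (- c) = e1 * int p"
      using e0 e1 by (simp_all add: c_def)
    then have "int p dvd 4 * int i0 - c" "int p dvd 4 * int i1 - (- c)" by simp_all
    moreover have "\<not> int p dvd - c" using cp by simp
    ultimately have "[c * P0 = 1] (mod int p)" and "[- c * P1 = 1] (mod int p)"
      unfolding P0_def P1_def using linear_product_cong[OF p \<open>odd p\<close>] assms(3,4) cp by blast+
    then have "[(c * P0) * (- c * P1) = 1 * 1] (mod int p)" by (rule cong_mult)
    then have "[- ((c * P0) * (- c * P1)) = - (1 * 1)] (mod int p)" by (simp only: cong_minus_minus_iff)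
    then show ?thesis by (simp add: power2_eq_square mult_ac)
  qed
  have wil: "[fact (p - 1) = (- 1 :: int)] (mod int p)" by (rule wilson_theorem[OF p])
  \<comment> \<open>For M = m the reflected factorial is m! itself, so (m!)^2 is 1 or -1 modulo
    p.\<close>
  have m4: "[fact m ^ 4 = (1 :: int)] (mod int p)"
  proof -
    have "[fact (p - 1 - m) * fact m = - ((-1) ^ m :: int)] (mod int p)"
      by (rule fact_reflect_cong(1)[OF p]) (use pm in auto)
    moreover have "p - 1 - m = m" by (simp add: pm)
    ultimately have "[(fact m * fact m)\<^sup>2 = (- ((-1) ^ m) :: int)\<^sup>2] (mod int p)" by (metis cong_pow)
    then show ?thesis by (simp add: power2_eq_square power4_eq_xxxx mult_ac flip: power_mult_distrib)
  qed
  have den: "[den = (-1) ^ M] (mod int p)"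
  proof -
    have "[(2 :: nat) ^ (p - 1) = 1] (mod p)"
      by (rule fermat_theorem[OF p]) (use p3 in \<open>auto dest: dvd_imp_le\<close>)
    then have "[int (2 ^ (p - 1)) = int 1] (mod int p)" by (simp only: cong_int_iff)
    then have "[int (2 ^ (p - 1)) ^ 4 = int 1 ^ 4] (mod int p)" by (rule cong_pow)
    moreover have "int (2 ^ (p - 1)) ^ 4 = 16 ^ (p - 1)"
      by (simp add: power4_eq_xxxx flip: power_mult_distrib)
    ultimately have "[(16 :: int) ^ (p - 1) = 1] (mod int p)" by simp
    moreover have "[fact (p - 1) ^ 3 = (- 1 :: int) ^ 3] (mod int p)" using wil by (rule cong_pow)
    moreover have "[fact (p - 1 - M) * pochhammer (int p + 1) M = - ((-1) ^ M)] (mod int p)"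
      using fact_reflect_cong[OF p assms(1)] by (meson cong_mult cong_refl cong_trans)
    ultimately have "[den = 1 * (- 1) ^ 3 * (- ((-1) ^ M))] (mod int p)"
      unfolding den_def by (intro cong_mult)
    then show ?thesis by simp
  qed
  have den_nd: "\<not> int p dvd den"
  proof
    assume "int p dvd den"
    then have "int p dvd (-1) ^ M" using den by (metis cong_dvd_iff)
    then show False using p by (auto simp: prime_nat_iff minus_one_power_iff split: if_splits)
  qed
  have "[num * c\<^sup>2 = (- ((-1) ^ M * (e0 * e1))) * den] (mod int p)"
  proof -
    have "[e0 * e1 * (c\<^sup>2 * (P0 * P1)) * fact m ^ 4 = e0 * e1 * (- 1) * 1] (mod int p)"
      using PP m4 by (intro cong_mult cong_refl)
    moreover have "[- ((-1) ^ M * (e0 * e1)) * den = - ((-1) ^ M * (e0 * e1)) * (-1) ^ M] (mod int p)"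
      using den by (intro cong_mult cong_refl)
    moreover have "- ((-1) ^ M * (e0 * e1)) * (-1) ^ M = e0 * e1 * (- 1) * 1"
      by (simp add: mult_ac flip: power_mult_distrib)
    moreover have "e0 * e1 * (c\<^sup>2 * (P0 * P1)) * fact m ^ 4 = num * c\<^sup>2"
      by (simp add: num_def mult_ac)
    ultimately show ?thesis by (metis cong_sym cong_trans)
  qed
  then have nd: "rat_cong (of_int num / of_int den) (of_int (- ((-1) ^ M * (e0 * e1))) / of_int (c\<^sup>2)) p 1"
    using den_nd cp p by (intro rat_cong_divide_int) (auto simp: prime_dvd_power_iff)
  have a: "rat_cong a 1 p 1"
    using rat_cong_weaken[OF p prod_half_cong, of 1] by (simp add: a_def x_def)
  have inta: "p_integral p a"
  proof -
    obtain d where "p_integral p d" "a - 1 = of_nat p ^ 1 * d" using a unfolding rat_cong_iff by blast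
    then have "a = 1 + of_nat p * d" by simp
    then show ?thesis using \<open>p_integral p d\<close> p by simp
  qed
  have intn: "p_integral p (of_int num / of_int den)"
    using den_nd p by (intro p_integral_divide_int) auto
  have "rat_cong (a * a) (1 * 1) p 1"
    using a inta p by (intro rat_cong_mult) auto
  then have "rat_cong (of_int num / of_int den * (a * a)) (of_int num / of_int den * 1) p 1"
    using intn p by (intro rat_cong_mult_left) auto
  then have "rat_cong (of_int num / of_int den * (a * a)) (of_int (- ((-1) ^ M * (e0 * e1))) / of_int (c\<^sup>2)) p 1"
    using rat_cong_trans[OF p _ nd] by simp
  then have "rat_cong (of_nat p ^ 3 * (of_int num / of_int den * (a * a)))
     (of_nat p ^ 3 * (of_int (- ((-1) ^ M * (e0 * e1))) / of_int (c\<^sup>2))) p (3 + 1)"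
    using p by (intro rat_cong_mult_power) auto
  moreover have "node_term p M = of_nat p ^ 3 * (of_int num / of_int den * (a * a))"
  proof -
    have P: "pochhammer (1/2) p = x / 2 * ((-1) ^ m * ((fact m)\<^sup>2 * a))"
      using pochhammer_half_odd[of x m] by (simp add: x_def pm a_def)
    have F: "fact (p + M) = x * fact (p - 1) * of_int (pochhammer (int p + 1) M)"
    proof -
      have "fact (p + M) = fact p * (pochhammer (1 + of_nat p) M :: rat)"
        using pochhammer_product'[of "1 :: rat" p M] by (simp add: pochhammer_fact)
      moreover have "fact p = x * fact (p - 1)"
        using p by (simp add: x_def fact_reduce prime_gt_0_nat)
      moreover have "pochhammer (1 + of_nat p) M = (of_int (pochhammer (int p + 1) M) :: rat)"
        by (simp add: pochhammer_of_int[symmetric] add.commute)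
      ultimately show ?thesis by simp
    qed
    have G: "(\<Prod>i=1..<p. 1 - (2 * of_nat M + 1)\<^sup>2 / (16 * (of_nat i)\<^sup>2)) =
      x\<^sup>2 * of_int (e0 * e1 * P0 * P1) / (16 ^ (p - 1) * (fact (p - 1))\<^sup>2)"
    proof -
      have "(\<Prod>i=1..<p. 1 - (2 * of_nat M + 1)\<^sup>2 / (16 * (of_nat i)\<^sup>2)) =
        (\<Prod>i=1..<p. (of_int (4 * int i - c) * of_int (4 * int i - (- c))) / (16 * (of_nat i)\<^sup>2) :: rat)"
      proof (intro prod.cong refl)
        fix i assume "i \<in> {1..<p}"
        then have "(of_nat i :: rat) \<noteq> 0" by simp
        then show "1 - (2 * of_nat M + 1)\<^sup>2 / (16 * (of_nat i)\<^sup>2) =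
          (of_int (4 * int i - c) * of_int (4 * int i - (- c))) / (16 * (of_nat i)\<^sup>2 :: rat)"
          by (simp add: c_def divide_simps) (simp add: power2_eq_square algebra_simps)
      qed
      also have "\<dots> = of_int (\<Prod>i=1..<p. 4 * int i - c) * of_int (\<Prod>i=1..<p. 4 * int i - (- c)) /
          (\<Prod>i=1..<p. 16 * (of_nat i)\<^sup>2)"
        by (simp only: prod_dividef prod.distrib of_int_prod)
      also have "(\<Prod>i=1..<p. 4 * int i - c) = e0 * int p * P0"
        unfolding P0_def using assms(3) e0 by (subst prod.remove[of _ i0]) (auto simp: c_def)
      also have "(\<Prod>i=1..<p. 4 * int i - (- c)) = e1 * int p * P1"
        unfolding P1_def using assms(4) e1 by (subst prod.remove[of _ i1]) (auto simp: c_def)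
      also have "(\<Prod>i=1..<p. 16 * (of_nat i)\<^sup>2) = (16 ^ (p - 1) * (fact (p - 1))\<^sup>2 :: rat)"
      proof -
        have "{1..<p} = {1..p - 1}" using p3 by auto
        then show ?thesis by (simp add: prod.distrib fact_prod prod_power_distrib)
      qed
      finally show ?thesis by (simp add: x_def power2_eq_square mult_ac)
    qed
    have x0: "x \<noteq> 0" using p by (simp add: x_def prime_gt_0_nat)
    have "node_term p M = 4 * (x / 2 * (s * (f\<^sup>2 * a)))\<^sup>2 / (h * (x * k * q)) * (x\<^sup>2 * e / (r * k\<^sup>2))"
      if "s = (-1) ^ m" "f = fact m" "h = fact (p - 1 - M)" "k = fact (p - 1)" "q = of_int (pochhammer (int p + 1) M)"
        "e = of_int (e0 * e1 * P0 * P1)" "r = 16 ^ (p - 1)" for s f h k q e r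
      unfolding node_term_def G P F that ..
    moreover have "4 * (x / 2 * (s * (f\<^sup>2 * a)))\<^sup>2 / (h * (x * k * q)) * (x\<^sup>2 * e / (r * k\<^sup>2)) =
        x ^ 3 * (e * f ^ 4 / (r * k ^ 3 * (h * q)) * (a * a))"
      if "s * s = 1" for s f h k q e r
    proof -
      have square: "4 * (x / 2 * (s * (f\<^sup>2 * a)))\<^sup>2 = (s * s) * (x\<^sup>2 * (f ^ 4 * (a * a)))"
        by (simp add: power2_eq_square power4_eq_xxxx mult_ac)
      show ?thesis
        unfolding square that using x0 by (simp add: power2_eq_square power3_eq_cube mult_ac)
    qed
    moreover have "(-1) ^ m * (-1) ^ m = (1 :: rat)" by (simp flip: power_mult_distrib)
    ultimately show ?thesis by (simp add: x_def num_def den_def)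
  qed
  ultimately show ?thesis by (simp add: c_def)
qed

text \<open>The two indices with a factor divisible by p are explicit once the parity of M + m is
  known; they add up to p, so e0 + e1 = 4. For M < m the cofactors are 3 and 1 in some order. At p -
  1 - M they are -1 and 5 if M + m is even, and 1 and 3 if it is odd, which the factor 1 + 4
  (-1)^(M+m) encodes.\<close>

lemma noncentral_node_term:
  assumes "M < m"
  shows "rat_cong (node_term p M) (of_nat p ^ 3 * (- ((-1) ^ M * 3) / (of_nat (2 * M + 1))\<^sup>2)) p 4"
    and "rat_cong (node_term p (p - 1 - M)) (of_nat p ^ 3 * ((-1) ^ M * (1 + 4 * (-1) ^ (M + m)) / (of_nat (2 * (p - 1 - M) + 1))\<^sup>2)) p 4"
proof -
  define N where "N = p - 1 - M"
  have N: "m < N" "N < p" "even N = even M" "int N = 2 * int m - int M"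
    using assms pm by (auto simp: N_def)
  have sgn: "(-1) ^ N = ((-1) ^ M :: rat)" using N(3) by (simp add: minus_one_power_iff)
  \<comment> \<open>Positivity makes k itself admissible as one of the two indices.\<close>
  have even_dist: "\<exists>k>0. m = M + 2 * k" if "even (M + m)"
    using that assms by presburger
  have odd_dist: "\<exists>k. m = M + 2 * k + 1" if "odd (M + m)"
    using that assms by presburger
  show "rat_cong (node_term p M) (of_nat p ^ 3 * (- ((-1) ^ M * 3) / (of_nat (2 * M + 1))\<^sup>2)) p 4"
  proof (cases "even (M + m)")
    case True
    then obtain k where k: "m = M + 2 * k" "k > 0" using even_dist by blast
    have "rat_cong (node_term p M) (of_nat p ^ 3 * (- ((-1) ^ M * of_int (3 * 1)) / (2 * of_nat M + 1)\<^sup>2)) p 4"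
      by (rule noncentral_node_term_aux[of M "2 * M + 3 * k + 1" k]) (use k pm in auto)
    then show ?thesis by (simp add: add.commute)
  next
    case False
    then obtain k where k: "m = M + 2 * k + 1" using odd_dist by blast
    have "rat_cong (node_term p M) (of_nat p ^ 3 * (- ((-1) ^ M * of_int (1 * 3)) / (2 * of_nat M + 1)\<^sup>2)) p 4"
      by (rule noncentral_node_term_aux[of M "M + k + 1" "M + 3 * k + 2"]) (use k pm in auto)
    then show ?thesis by (simp add: add.commute)
  qed
  show "rat_cong (node_term p (p - 1 - M)) (of_nat p ^ 3 * ((-1) ^ M * (1 + 4 * (-1) ^ (M + m)) / (of_nat (2 * (p - 1 - M) + 1))\<^sup>2)) p 4"
    unfolding N_def[symmetric]
  proof (cases "even (M + m)")
    case True
    then obtain k where k: "m = M + 2 * k" "k > 0" using even_dist by blast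
    then have N': "N = M + 4 * k" by (simp add: N_def pm)
    have "rat_cong (node_term p N) (of_nat p ^ 3 * (- ((-1) ^ N * of_int (-1 * 5)) / (2 * of_nat N + 1)\<^sup>2)) p 4"
      by (rule noncentral_node_term_aux[of N k "2 * M + 3 * k + 1"]) (use k N' pm in auto)
    then show "rat_cong (node_term p N) (of_nat p ^ 3 * ((-1) ^ M * (1 + 4 * (-1) ^ (M + m)) / (of_nat (2 * N + 1))\<^sup>2)) p 4"
      using True by (simp add: sgn add.commute)
  next
    case False
    then obtain k where k: "m = M + 2 * k + 1" using odd_dist by blast
    then have N': "N = M + 4 * k + 2" by (simp add: N_def pm)
    have "rat_cong (node_term p N) (of_nat p ^ 3 * (- ((-1) ^ N * of_int (1 * 3)) / (2 * of_nat N + 1)\<^sup>2)) p 4"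
      by (rule noncentral_node_term_aux[of N "M + 3 * k + 2" "M + k + 1"]) (use k N' pm in auto)
    then show "rat_cong (node_term p N) (of_nat p ^ 3 * ((-1) ^ M * (1 + 4 * (-1) ^ (M + m)) / (of_nat (2 * N + 1))\<^sup>2)) p 4"
      using False by (simp add: sgn add.commute)
  qed
qed

section \<open>Summation by the reflection of M to p - 1 - M\<close>

lemma sum_split_reflect:
  fixes f :: "nat \<Rightarrow> rat"
  shows "(\<Sum>M<p. f M) = f m + (\<Sum>M<m. f M + f (p - 1 - M))"
proof -
  have "(\<Sum>M<p. f M) = (\<Sum>M<m. f M) + (\<Sum>M=m..<p. f M)"
    unfolding lessThan_atLeast0 by (rule sum.atLeastLessThan_concat[symmetric]) (use pm in auto)
  also have "(\<Sum>M=m..<p. f M) = f m + (\<Sum>M=Suc m..<p. f M)"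
    by (rule sum.atLeast_Suc_lessThan) (use pm in auto)
  also have "(\<Sum>M=Suc m..<p. f M) = (\<Sum>M<m. f (p - 1 - M))"
    by (rule sum.reindex_bij_witness[of _ "\<lambda>M. p - 1 - M" "\<lambda>M. p - 1 - M"]) (use pm in auto)
  finally show ?thesis by (simp add: sum.distrib)
qed

text \<open>The odd numbers belonging to M and p - 1 - M add up to 2p, and p - 1 is even.\<close>

lemma node_reflect:
  assumes "M < m"
  shows "\<not> p dvd 2 * M + 1" "\<not> p dvd 2 * (p - 1 - M) + 1"
    and "rat_cong (1 / (of_nat (2 * (p - 1 - M) + 1))\<^sup>2) (1 / (of_nat (2 * M + 1))\<^sup>2) p 1"
    and "even (p - 1 - M) \<longleftrightarrow> even M"
proof -
  show nd: "\<not> p dvd 2 * M + 1" using assms pm by (auto dest: dvd_imp_le)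
  have sum: "(2 * (p - 1 - M) + 1) + (2 * M + 1) = 2 * p" using assms pm by simp
  show nd': "\<not> p dvd 2 * (p - 1 - M) + 1"
    using nd sum by (metis dvd_add_right_iff dvd_triv_right)
  show "rat_cong (1 / (of_nat (2 * (p - 1 - M) + 1))\<^sup>2) (1 / (of_nat (2 * M + 1))\<^sup>2) p 1"
    using sum nd' by (rule inverse_square_reflect[OF p])
  show "even (p - 1 - M) \<longleftrightarrow> even M" using assms pm by auto
qed

text \<open>By Fermat's theorem the power p - 3 of a number prime to p is its inverse square. In the
  sum of \<open>euler_num_cong_sum\<close> the middle term is a positive power of p, and reflected
  terms agree modulo p, hence the factor 2.\<close>

lemma euler_num_cong_alternating_sum:
  "rat_cong (of_int (euler_num (p - 3))) (\<Sum>M<m. 2 * ((-1) ^ M * (1 / (of_nat (2 * M + 1))\<^sup>2))) p 1"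
proof -
  define f :: "nat \<Rightarrow> rat" where "f = (\<lambda>k. of_int ((-1) ^ k * (2 * int k + 1) ^ (p - 3)))"
  have odd: "odd p" using pm by simp
  have pow: "rat_cong (f k) ((-1) ^ k * (1 / (of_nat (2 * k + 1))\<^sup>2)) p 1" if "\<not> p dvd 2 * k + 1" for k
  proof -
    have "p - 1 = (p - 3) + 2" using p3 by simp
    then have "(2 * k + 1) ^ (p - 3) * (2 * k + 1)\<^sup>2 = (2 * k + 1) ^ (p - 1)"
      by (simp only: power_add)
    then have "[(2 * k + 1) ^ (p - 3) * (2 * k + 1)\<^sup>2 = 1] (mod p)"
      using fermat_theorem[OF p that] by simp
    then have "[int ((2 * k + 1) ^ (p - 3) * (2 * k + 1)\<^sup>2) = int 1] (mod int p)"
      by (simp only: cong_int_iff)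
    then have "[(2 * int k + 1) ^ (p - 3) * (2 * int k + 1)\<^sup>2 = 1 * 1] (mod int p)"
      by (simp add: add.commute)
    moreover have "\<not> int p dvd (2 * int k + 1)\<^sup>2"
    proof
      assume "int p dvd (2 * int k + 1)\<^sup>2"
      then have "int p dvd int (2 * k + 1)" using p by (simp add: prime_dvd_power_iff add.commute)
      then show False using that by (simp only: int_dvd_int_iff)
    qed
    moreover have "\<not> int p dvd 1" using p3 by simp
    ultimately have "rat_cong (of_int ((2 * int k + 1) ^ (p - 3)) / of_int 1) (of_int 1 / of_int ((2 * int k + 1)\<^sup>2)) p 1"
      by (intro rat_cong_divide_int[OF p])
    then have "rat_cong ((-1) ^ k * (of_int ((2 * int k + 1) ^ (p - 3)) / of_int 1)) ((-1) ^ k * (of_int 1 / of_int ((2 * int k + 1)\<^sup>2))) p 1"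
      by (rule rat_cong_mult_left[OF p]) (use p in auto)
    then show ?thesis by (simp add: f_def add.commute)
  qed
  have "rat_cong (f m) 0 p 1"
  proof -
    have "2 * int m + 1 = int p" by (simp add: pm)
    then have "[(2 * int m + 1) ^ (p - 3) = 0] (mod int p)"
      using p3 by (simp only: cong_0_iff) (intro dvd_power, simp)
    then have "[(-1) ^ m * (2 * int m + 1) ^ (p - 3) = (-1) ^ m * 0] (mod int p)"
      by (intro cong_mult cong_refl)
    from rat_cong_of_int[OF p this] show ?thesis by (simp add: f_def)
  qed
  moreover have "rat_cong (\<Sum>M<m. f M + f (p - 1 - M)) (\<Sum>M<m. 2 * ((-1) ^ M * (1 / (of_nat (2 * M + 1))\<^sup>2))) p 1"
  proof (rule rat_cong_sum[OF p])
    fix M assume "M \<in> {..<m}"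
    then have M: "M < m" by simp
    have "(-1) ^ (p - 1 - M) = ((-1) ^ M :: rat)"
      using node_reflect(4)[OF M] by (simp add: minus_one_power_iff)
    then have "rat_cong (f (p - 1 - M)) ((-1) ^ M * (1 / (of_nat (2 * (p - 1 - M) + 1))\<^sup>2)) p 1"
      using pow[OF node_reflect(2)[OF M]] by simp
    moreover have "rat_cong ((-1) ^ M * (1 / (of_nat (2 * (p - 1 - M) + 1))\<^sup>2)) ((-1) ^ M * (1 / (of_nat (2 * M + 1))\<^sup>2)) p 1"
      by (rule rat_cong_mult_left[OF p node_reflect(3)[OF M]]) (use p in auto)
    ultimately have "rat_cong (f (p - 1 - M)) ((-1) ^ M * (1 / (of_nat (2 * M + 1))\<^sup>2)) p 1"
      by (rule rat_cong_trans[OF p])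
    from rat_cong_add[OF p pow[OF node_reflect(1)[OF M]] this]
    show "rat_cong (f M + f (p - 1 - M)) (2 * ((-1) ^ M * (1 / (of_nat (2 * M + 1))\<^sup>2))) p 1"
      by (simp only: mult_2)
  qed
  ultimately have sum_f: "rat_cong (\<Sum>k<p. f k) (0 + (\<Sum>M<m. 2 * ((-1) ^ M * (1 / (of_nat (2 * M + 1))\<^sup>2)))) p 1"
    unfolding sum_split_reflect by (rule rat_cong_add[OF p])
  have "rat_cong (of_int (euler_num (p - 3))) (\<Sum>k<p. f k) p 1"
    using rat_cong_of_int[OF p euler_num_cong_sum[OF odd, of "p - 3"]] by (simp only: f_def of_int_sum)
  from rat_cong_trans[OF p this sum_f] show ?thesis by (simp only: add_0)
qed

text \<open>Modulo p a reflected pair contributes (-1)^M (-3 + 1 + 4 (-1)^(M+m)) / (2M+1)^2 to the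
  coefficient of p^3. The part -2 (-1)^M sums to -E_(p-3). The other part has the constant sign
  (-1)^m, so it is a multiple of the sum of inverse odd squares and vanishes.\<close>

lemma sum_node_terms:
  "rat_cong (\<Sum>M<p. node_term p M) (of_nat p * (-1) ^ m - of_nat p ^ 3 * of_int (euler_num (p - 3))) p 4"
proof -
  define r :: "nat \<Rightarrow> rat" where "r = (\<lambda>k. 1 / (of_nat (2 * k + 1))\<^sup>2)"
  define u :: "nat \<Rightarrow> rat" where
    "u = (\<lambda>M. - ((-1) ^ M * 3) * r M + (-1) ^ M * (1 + 4 * (-1) ^ (M + m)) * r (p - 1 - M))"
  have "rat_cong (\<Sum>M<m. node_term p M + node_term p (p - 1 - M)) (\<Sum>M<m. of_nat p ^ 3 * u M) p 4"
  proof (rule rat_cong_sum[OF p])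
    fix M assume "M \<in> {..<m}"
    then have "M < m" by simp
    from rat_cong_add[OF p noncentral_node_term[OF this]]
    show "rat_cong (node_term p M + node_term p (p - 1 - M)) (of_nat p ^ 3 * u M) p 4"
      unfolding u_def r_def by (simp only: distrib_left[of "of_nat p ^ 3"] times_divide_eq_right mult_1_right)
  qed
  moreover have "rat_cong (\<Sum>M<m. of_nat p ^ 3 * u M) (of_nat p ^ 3 * (- of_int (euler_num (p - 3)))) p 4"
  proof -
    have "rat_cong (sum u {..<m}) (\<Sum>M<m. - (2 * ((-1) ^ M * r M)) + 4 * (-1) ^ m * r M) p 1"
    proof (rule rat_cong_sum[OF p])
      fix M assume "M \<in> {..<m}"
      then have "M < m" by simp
      then have "rat_cong (r (p - 1 - M)) (r M) p 1" unfolding r_def by (rule node_reflect(3))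
      then have "rat_cong ((-1) ^ M * (1 + 4 * (-1) ^ (M + m)) * r (p - 1 - M)) ((-1) ^ M * (1 + 4 * (-1) ^ (M + m)) * r M) p 1"
        by (rule rat_cong_mult_left[OF p]) (use p in auto)
      from rat_cong_add[OF p rat_cong_refl[OF p, of "- ((-1) ^ M * 3) * r M"] this]
      have "rat_cong (u M) (- ((-1) ^ M * 3) * r M + (-1) ^ M * (1 + 4 * (-1) ^ (M + m)) * r M) p 1"
        by (simp only: u_def)
      moreover have "(-1) ^ M * (1 + 4 * (-1) ^ (M + m)) = (-1) ^ M + 4 * (-1 :: rat) ^ m"
        by (cases "even M") (simp_all add: power_add)
      ultimately show "rat_cong (u M) (- (2 * ((-1) ^ M * r M)) + 4 * (-1) ^ m * r M) p 1"
        by (simp add: algebra_simps)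
    qed
    moreover have "(\<Sum>M<m. - (2 * ((-1) ^ M * r M)) + 4 * (-1) ^ m * r M) =
        - 1 * (\<Sum>M<m. 2 * ((-1) ^ M * r M)) + 4 * (-1) ^ m * sum r {..<m}"
      unfolding sum.distrib sum_negf sum_distrib_left[symmetric] by simp
    moreover have "rat_cong (- 1 * (\<Sum>M<m. 2 * ((-1) ^ M * r M)) + 4 * (-1) ^ m * sum r {..<m}) (- 1 * of_int (euler_num (p - 3)) + 4 * (-1) ^ m * 0) p 1"
    proof (intro rat_cong_add[OF p] rat_cong_mult_left[OF p])
      show "rat_cong (\<Sum>M<m. 2 * ((-1) ^ M * r M)) (of_int (euler_num (p - 3))) p 1"
        unfolding r_def by (rule rat_cong_sym[OF p euler_num_cong_alternating_sum])
      show "rat_cong (sum r {..<m}) 0 p 1"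
        unfolding r_def by (rule sums_inverse_squares(3)[OF p p3 pm])
    qed (use p in auto)
    ultimately have "rat_cong (sum u {..<m}) (- 1 * of_int (euler_num (p - 3)) + 4 * (-1) ^ m * 0) p 1"
      using rat_cong_trans[OF p] by (simp only:)
    then have "rat_cong (sum u {..<m}) (- of_int (euler_num (p - 3))) p 1" by simp
    from rat_cong_mult_power[OF p this, of 3] show ?thesis by (simp add: sum_distrib_left)
  qed
  ultimately have "rat_cong (\<Sum>M<m. node_term p M + node_term p (p - 1 - M)) (of_nat p ^ 3 * (- of_int (euler_num (p - 3)))) p 4"
    by (rule rat_cong_trans[OF p])
  from rat_cong_add[OF p central_node_term this] show ?thesis
    unfolding sum_split_reflect[of "node_term p"] by simp
qed

end

theorem theorem1p1:
  fixes p :: nat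
  assumes "prime p" and "p > 3"
  shows "rat_cong
    (\<Sum>n=0..p-1. of_nat (6*n+1) / 256 ^ n * of_nat ((2*n) choose n) ^ 3)
    (of_nat p * (-1) ^ ((p - 1) div 2) - of_nat p ^ 3 * of_int (euler_num (p - 3)))
    p 4"
proof -
  have "odd p" using assms prime_odd_nat by auto
  then obtain m where m: "p = 2 * m + 1" by (rule oddE)
  have "{0..p-1} = {..<p}" using assms(2) by auto
  then have "(\<Sum>n=0..p-1. of_nat (6*n+1) / 256 ^ n * of_nat ((2*n) choose n) ^ 3) = (\<Sum>M<p. node_term p M)"
    using sum_deformed_term_0[of p, where 'a = rat] assms(2)
    unfolding deformed_term_0 node_term_def by simp
  moreover have "(p - 1) div 2 = m" using m by simp
  ultimately show ?thesis using sum_node_terms[OF assms m] by (simp only:)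
qed

end
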